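(* Consider the two-dimensional DG scheme with Euler forward time discretization described in the context. Suppose $0\le r^n\le\Phi$ and that the following conditions hold: $r^n>0$ (hence $c^n>0$), $$\alpha>\max_{1\le i\le N_x-1,\ 1\le j\le N_y-1,\ \beta=1,2}\{(u_1)^+_{i+\frac12,j,\beta},(u_2)^+_{i,j+\frac12,\beta},0\},$$ $$\tilde\alpha\ge\frac{\Delta y}{2\Delta x}D_{11}^M+\sqrt3D_{12}^M,\qquad \tilde\alpha\ge\frac{\Delta x}{2\Delta y}D_{22}^M+\sqrt3D_{21}^M,$$ $$\frac{\Delta t}{\Delta x}+\frac{\Delta t}{\Delta y}\le\frac16\min\left\{\frac{\Phi_m}{\alpha},B_1,B_2\right\},$$ $$D_{11}^M\Lambda_1+2(\tilde\alpha+D_{12}^M)\lambda\le\frac1{12}\Phi_m,\qquad D_{22}^M\Lambda_2+2(\tilde\alpha+D_{21}^M)\lambda\le\frac1{12}\Phi_m,$$ $$\Delta t\le\frac1{6z_1p_M},\qquad \Delta t\le\min_{i,j}\frac{\Phi^m_{ij}}{6\max_{\beta,\gamma}\{-q(x_i^\beta,y_j^\gamma),0\}}.$$ Moreover, suppose that the fluxes $\widehat{{\bf u}c}$ and $\hat{\bf u}$ are consistent and that $$\Delta t\le\frac{1}{6z_2p_M}.$$ Then $\bar r_{ij}^{n+1}\le\bar\Phi_{ij}$ for all cells $K_{ij}$ away from $\partial\Omega$ (i.e. $2\le i\le N_x-1$, $2\le j\le N_y-1$).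
   Context: Mesh and spaces. $\Omega=[0,2\pi]^2$ is partitioned uniformly into rectangles $K_{ij}=I_i\times J_j$, $I_i=(x_{i-\frac12},x_{i+\frac12})$, $J_j=(y_{j-\frac12},y_{j+\frac12})$, $1\le i\le N_x$, $1\le j\le N_y$, with side lengths $\Delta x,\Delta y$. $W_h$ is the space of functions whose restriction to each cell is in $Q^1$ (tensor products of linear polynomials), ${\bf W}_h=W_h\times W_h$. $\Gamma$ is the set of cell interfaces (edges), $\Gamma_0=\Gamma\setminus\partial\Omega$; $|e|$ is the length of $e$. ${\bf n}_e=(1,0)$ on vertical edges, $(0,1)$ on horizontal edges. On an interior edge, $v^-$ is the trace from the left (resp. lower) cell, $v^+$ from the right (resp. upper) cell; $[v]=v^+-v^-$, $\{v\}=\frac12(v^++v^-)$. Traces from outside $\Omega$ are set to $0$. $\partial\Omega_+$ is the right and top part of $\partial\Omega$, $\partial\Omega_-$ the left and bottom part. $\bar v_{ij}$ is the average of $v$ over $K_{ij}$. $(v,w)=\int_\Omega vw\,dxdy$. The 2-point Gauss points on $I_i$, $J_j$ are $x_i^1,x_i^2$, $y_j^1,y_j^2$; a third subscript $\beta$ denotes evaluation at the corresponding Gauss point of an edge, e.g. $v^\pm_{i+\frac12,j,\beta}=v^\pm(x_{i+\frac12},y_j^\beta)$, $v^\pm_{i,j+\frac12,\beta}=v^\pm(x_i^\beta,y_{j+\frac12})$. Data. $\phi>0$ is the porosity; $\Phi\in W_h$ is the continuous interpolant equal to $\phi$ at the cell corners, $\Phi_{i+\frac12,j+\frac12}=\phi(x_{i+\frac12},y_{j+\frac12})$.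 For a function $g$, $\mathcal I_1 g\in W_h$ is the cellwise $Q^1$ interpolant at the four corners of each cell (using values from within the cell). $z_1,z_2>0$ are compressibility factors; $a(c)=\mu(c)/\kappa$ ($\mu$ viscosity, $\kappa$ permeability); $q$ is the external flow rate; $\tilde c\in[0,1]$ is the concentration in the external flow, equal to the numerical $c$ at points where $q<0$. ${\bf D}({\bf u})$ is a symmetric positive semidefinite $2\times2$ matrix with entries $D_{k\ell}$. $\alpha,\tilde\alpha$ are positive constants. $c=\mathcal I_1\{r/\Phi\}$, $\tilde d(r)=z_1r+z_2(\Phi-r)$. Scheme. $p,r\in W_h$, ${\bf u}=(u_1,u_2)\in{\bf W}_h$ such that for all $\xi,\zeta\in W_h$, $\boldsymbol\eta\in{\bf W}_h$: $$(\tilde d(r)p_t,\xi)=({\bf u},\nabla\xi)+\sum_{e\in\Gamma_0}\int_e\hat{\bf u}[\xi]\cdot{\bf n}_e\,ds+(q,\xi),$$ $$(a(c){\bf u},\boldsymbol\eta)=(p,\nabla\cdot\boldsymbol\eta)+\sum_{e\in\Gamma}\int_e\hat p[\boldsymbol\eta\cdot{\bf n}_e]\,ds,$$ $$(r_t,\zeta)=({\bf u}c-{\bf D}({\bf u})\nabla c,\nabla\zeta)+(\tilde cq-rz_1p_t,\zeta)+\sum_{e\in\Gamma_0}\int_e\widehat{{\bf u}c}\cdot{\bf n}_e[\zeta]\,ds-\sum_{e\in\Gamma_0}\int_e\Big(\{{\bf D}({\bf u})\nabla c\cdot{\bf n}_e\}[\zeta]+\{{\bf D}({\bf u})\nabla\zeta\cdot{\bf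 n}_e\}[c]+\frac{\tilde\alpha}{|e|}[c][\zeta]\Big)ds,$$ with, on $\Gamma_0$, $\hat{\bf u}={\bf u}^+$, $\hat p=p^-$, and (componentwise normal flux) $\widehat{u_kc}=u_k^+c^+-\alpha[c]$, $k=1,2$ ($k=1$ on vertical, $k=2$ on horizontal edges); on $\partial\Omega$, $\hat{\bf u}=0$, $\hat p=p^-$ on $\partial\Omega_+$ and $\hat p=p^+$ on $\partial\Omega_-$. The fluxes $\widehat{{\bf u}c},\hat{\bf u}$ are called consistent if $\widehat{{\bf u}c}=\hat{\bf u}$ when $c=1$ in $\Omega$ (the fluxes just given have this property). Edge integrals and source integrals over cells are evaluated by (tensor-product) 2-point Gaussian quadrature, in all equations. Euler forward: all quantities are at time level $n$ (superscript omitted), $p_t\in W_h$ satisfies the first equation, and $r^{n+1}\in W_h$ is given by the third with $r_t=(r^{n+1}-r^n)/\Delta t$, $\Delta t>0$. Notation. $\lambda=\frac{\Delta t}{\Delta x\Delta y}$, $\Lambda_1=\frac{\Delta t}{\Delta x^2}$, $\Lambda_2=\frac{\Delta t}{\Delta y^2}$. $\Phi_m=\min_{0\le i\le N_x,0\le j\le N_y}\Phi_{i+\frac12,j+\frac12}$; $\Phi^m_{ij}$ is the minimum of $\Phi$ over the four corners of $K_{ij}$. $$B_1=\min_{1\le i\le N_x-1,\,1\le j\le N_y,\,\beta=1,2}\frac{\Phi_{i+\frac12,j\pm\frac12}}{\alpha-(u_1)^+_{i+\frac12,j,\beta}},\qquad B_2=\min_{1\le i\le N_x,\,1\le j\le N_y-1,\,\beta=1,2}\frac{\Phi_{i\pm\frac12,j+\frac12}}{\alpha-(u_2)^+_{i,j+\frac12,\beta}}$$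 (minimum also over both signs). $D_{kk}^M=\max_\Omega D_{kk}({\bf u})$, $D_{12}^M=\max_\Omega|D_{12}({\bf u})|$, $D_{21}^M=\max_\Omega|D_{21}({\bf u})|$, where maxima include one-sided traces on cell edges. $p_M=\max\{p_t(x_i^\beta,y_j^\gamma),0\}$, maximum over all $i,j$ and $\beta,\gamma\in\{1,2\}$. Inequalities on $r^n$ hold on every closed cell (including traces). A fraction with zero denominator is interpreted as $+\infty$. *)

theory Defs
  imports "HOL-Analysis.Analysis"
begin

definition mesh_size :: "nat \<Rightarrow> real" where
  "mesh_size N = 2 * pi / real N"

text \<open>The node \<open>node N i\<close> is $x_{i+1/2}$ (or $y_{i+1/2}$), \<open>0 \<le> i \<le> N\<close>, so that the cell interval with
  index \<open>i\<close>, \<open>1 \<le> i \<le> N\<close>, is bounded by \<open>node N (i - 1)\<close> and \<open>node N i\<close>.\<close>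

definition node :: "nat \<Rightarrow> nat \<Rightarrow> real" where
  "node N i = real i * mesh_size N"

definition cell :: "nat \<Rightarrow> nat \<Rightarrow> nat \<Rightarrow> nat \<Rightarrow> (real \<times> real) set" where
  "cell Nx Ny i j = {node Nx (i - 1)..node Nx i} \<times> {node Ny (j - 1)..node Ny j}"

definition gauss :: "nat \<Rightarrow> nat \<Rightarrow> nat \<Rightarrow> real" where
  "gauss N i \<beta> = (real i - 1/2) * mesh_size N
     + (if \<beta> = 1 then - 1 else 1) * mesh_size N / (2 * sqrt 3)"

text \<open>\<open>Vert i j\<close> is the edge $\{x_{i+1/2}\} \times J_j$ and \<open>Horz i j\<close> is the edge
  $I_i \times \{y_{j+1/2}\}$.\<close>

datatype edge = Vert nat nat | Horz nat nat

definition edges :: "nat \<Rightarrow> nat \<Rightarrow> edge set" where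
  "edges Nx Ny = (\<lambda>(i, j). Vert i j) ` ({0..Nx} \<times> {1..Ny})
               \<union> (\<lambda>(i, j). Horz i j) ` ({1..Nx} \<times> {0..Ny})"

fun boundary_minus :: "edge \<Rightarrow> bool" where
  "boundary_minus (Vert i j) = (i = 0)"
| "boundary_minus (Horz i j) = (j = 0)"

fun boundary_plus :: "nat \<Rightarrow> nat \<Rightarrow> edge \<Rightarrow> bool" where
  "boundary_plus Nx Ny (Vert i j) = (i = Nx)"
| "boundary_plus Nx Ny (Horz i j) = (j = Ny)"

definition interior_edges :: "nat \<Rightarrow> nat \<Rightarrow> edge set" where
  "interior_edges Nx Ny = {e \<in> edges Nx Ny. \<not> boundary_minus e \<and> \<not> boundary_plus Nx Ny e}"

fun edge_len :: "nat \<Rightarrow> nat \<Rightarrow> edge \<Rightarrow> real" where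
  "edge_len Nx Ny (Vert i j) = mesh_size Ny"
| "edge_len Nx Ny (Horz i j) = mesh_size Nx"

fun normal :: "edge \<Rightarrow> real^2" where
  "normal (Vert i j) = vector [1, 0]"
| "normal (Horz i j) = vector [0, 1]"

text \<open>A piecewise function is given by one function per cell: \<open>v i j x y\<close> is the value at
  \<open>(x, y)\<close> of the branch of \<open>v\<close> living on the closed cell with index \<open>(i, j)\<close>. On an edge the two
  adjacent branches therefore give the two one-sided traces.\<close>

type_synonym 'a cellwise = "nat \<Rightarrow> nat \<Rightarrow> real \<Rightarrow> real \<Rightarrow> 'a"

definition W_h :: "nat \<Rightarrow> nat \<Rightarrow> real cellwise set" where
  "W_h Nx Ny = {v. \<forall>i\<in>{1..Nx}. \<forall>j\<in>{1..Ny}. \<exists>a b c d. \<forall>x y.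
      v i j x y = a + b * x + c * y + d * x * y}"

definition WW_h :: "nat \<Rightarrow> nat \<Rightarrow> (real^2) cellwise set" where
  "WW_h Nx Ny = {v. \<forall>k. (\<lambda>i j x y. v i j x y $ k) \<in> W_h Nx Ny}"

definition branch :: "nat \<Rightarrow> nat \<Rightarrow> ('a::zero) cellwise \<Rightarrow> 'a cellwise" where
  "branch Nx Ny v i j x y = (if i \<in> {1..Nx} \<and> j \<in> {1..Ny} then v i j x y else 0)"

text \<open>Traces at the Gauss point with index \<open>\<beta>\<close> of an edge; those from outside the domain are 0.\<close>

fun trace_minus :: "nat \<Rightarrow> nat \<Rightarrow> ('a::zero) cellwise \<Rightarrow> edge \<Rightarrow> nat \<Rightarrow> 'a" where
  "trace_minus Nx Ny v (Vert i j) \<beta> = branch Nx Ny v i j (node Nx i) (gauss Ny j \<beta>)"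
| "trace_minus Nx Ny v (Horz i j) \<beta> = branch Nx Ny v i j (gauss Nx i \<beta>) (node Ny j)"

fun trace_plus :: "nat \<Rightarrow> nat \<Rightarrow> ('a::zero) cellwise \<Rightarrow> edge \<Rightarrow> nat \<Rightarrow> 'a" where
  "trace_plus Nx Ny v (Vert i j) \<beta> = branch Nx Ny v (i + 1) j (node Nx i) (gauss Ny j \<beta>)"
| "trace_plus Nx Ny v (Horz i j) \<beta> = branch Nx Ny v i (j + 1) (gauss Nx i \<beta>) (node Ny j)"

definition jump :: "nat \<Rightarrow> nat \<Rightarrow> ('a::real_vector) cellwise \<Rightarrow> edge \<Rightarrow> nat \<Rightarrow> 'a" where
  "jump Nx Ny v e \<beta> = trace_plus Nx Ny v e \<beta> - trace_minus Nx Ny v e \<beta>"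

definition mean :: "nat \<Rightarrow> nat \<Rightarrow> ('a::real_vector) cellwise \<Rightarrow> edge \<Rightarrow> nat \<Rightarrow> 'a" where
  "mean Nx Ny v e \<beta> = (1/2) *\<^sub>R (trace_plus Nx Ny v e \<beta> + trace_minus Nx Ny v e \<beta>)"

definition grad :: "real cellwise \<Rightarrow> (real^2) cellwise" where
  "grad v i j x y = vector [deriv (\<lambda>s. v i j s y) x, deriv (\<lambda>s. v i j x s) y]"

definition divergence :: "(real^2) cellwise \<Rightarrow> real cellwise" where
  "divergence v i j x y = deriv (\<lambda>s. v i j s y $ 1) x + deriv (\<lambda>s. v i j x s $ 2) y"

text \<open>The cellwise bilinear interpolant at the four corners of each cell.\<close>

definition interp :: "nat \<Rightarrow> nat \<Rightarrow> real cellwise \<Rightarrow> real cellwise" where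
  "interp Nx Ny g i j x y =
    (let xl = node Nx (i - 1); xr = node Nx i; yb = node Ny (j - 1); yt = node Ny j
     in (g i j xl yb * (xr - x) * (yt - y) + g i j xr yb * (x - xl) * (yt - y)
         + g i j xl yt * (xr - x) * (y - yb) + g i j xr yt * (x - xl) * (y - yb))
        / (mesh_size Nx * mesh_size Ny))"

definition vol_int :: "nat \<Rightarrow> nat \<Rightarrow> real cellwise \<Rightarrow> real" where
  "vol_int Nx Ny f = (\<Sum>i=1..Nx. \<Sum>j=1..Ny. integral (cell Nx Ny i j) (\<lambda>(x, y). f i j x y))"

definition cell_avg :: "nat \<Rightarrow> nat \<Rightarrow> real cellwise \<Rightarrow> nat \<Rightarrow> nat \<Rightarrow> real" where
  "cell_avg Nx Ny v i j =
     integral (cell Nx Ny i j) (\<lambda>(x, y). v i j x y) / (mesh_size Nx * mesh_size Ny)"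

text \<open>Two-point Gaussian quadrature: on cells it is used for the source integrals only, all other
  volume integrals being exact.\<close>

definition vol_quad :: "nat \<Rightarrow> nat \<Rightarrow> real cellwise \<Rightarrow> real" where
  "vol_quad Nx Ny f = (\<Sum>i=1..Nx. \<Sum>j=1..Ny. mesh_size Nx * mesh_size Ny / 4 *
     (\<Sum>\<beta>\<in>{1,2}. \<Sum>\<gamma>\<in>{1,2}. f i j (gauss Nx i \<beta>) (gauss Ny j \<gamma>)))"

definition edge_quad :: "nat \<Rightarrow> nat \<Rightarrow> edge \<Rightarrow> (edge \<Rightarrow> nat \<Rightarrow> real) \<Rightarrow> real" where
  "edge_quad Nx Ny e f = edge_len Nx Ny e / 2 * (\<Sum>\<beta>\<in>{1,2}. f e \<beta>)"

definition u_hat :: "nat \<Rightarrow> nat \<Rightarrow> (real^2) cellwise \<Rightarrow> edge \<Rightarrow> nat \<Rightarrow> real^2" where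
  "u_hat Nx Ny u e \<beta> = (if e \<in> interior_edges Nx Ny then trace_plus Nx Ny u e \<beta> else 0)"

definition p_hat :: "nat \<Rightarrow> nat \<Rightarrow> real cellwise \<Rightarrow> edge \<Rightarrow> nat \<Rightarrow> real" where
  "p_hat Nx Ny p e \<beta> =
     (if boundary_minus e then trace_plus Nx Ny p e \<beta> else trace_minus Nx Ny p e \<beta>)"

definition uc_hat ::
  "nat \<Rightarrow> nat \<Rightarrow> real \<Rightarrow> (real^2) cellwise \<Rightarrow> real cellwise \<Rightarrow> edge \<Rightarrow> nat \<Rightarrow> real^2" where
  "uc_hat Nx Ny \<alpha> u c e \<beta> =
     (\<chi> k. trace_plus Nx Ny u e \<beta> $ k * trace_plus Nx Ny c e \<beta> - \<alpha> * jump Nx Ny c e \<beta>)"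

definition consistent_fluxes ::
  "nat \<Rightarrow> nat \<Rightarrow> ((real^2) cellwise \<Rightarrow> real cellwise \<Rightarrow> edge \<Rightarrow> nat \<Rightarrow> real^2) \<Rightarrow>
   ((real^2) cellwise \<Rightarrow> edge \<Rightarrow> nat \<Rightarrow> real^2) \<Rightarrow> bool" where
  "consistent_fluxes Nx Ny F G \<longleftrightarrow>
     (\<forall>u\<in>WW_h Nx Ny. \<forall>c\<in>W_h Nx Ny.
        (\<forall>i\<in>{1..Nx}. \<forall>j\<in>{1..Ny}. \<forall>(x, y)\<in>cell Nx Ny i j. c i j x y = 1) \<longrightarrow>
        (\<forall>e\<in>interior_edges Nx Ny. \<forall>\<beta>\<in>{1,2}. F u c e \<beta> = G u e \<beta>))"

definition Phi :: "nat \<Rightarrow> nat \<Rightarrow> (real \<Rightarrow> real \<Rightarrow> real) \<Rightarrow> real cellwise" where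
  "Phi Nx Ny \<phi> = interp Nx Ny (\<lambda>i j. \<phi>)"

definition conc :: "nat \<Rightarrow> nat \<Rightarrow> (real \<Rightarrow> real \<Rightarrow> real) \<Rightarrow> real cellwise \<Rightarrow> real cellwise" where
  "conc Nx Ny \<phi> r = interp Nx Ny (\<lambda>i j x y. r i j x y / Phi Nx Ny \<phi> i j x y)"

definition pressure_eq ::
  "nat \<Rightarrow> nat \<Rightarrow> (real \<Rightarrow> real \<Rightarrow> real) \<Rightarrow> real \<Rightarrow> real \<Rightarrow> (real \<Rightarrow> real \<Rightarrow> real) \<Rightarrow>
   real cellwise \<Rightarrow> (real^2) cellwise \<Rightarrow> real cellwise \<Rightarrow> bool" where
  "pressure_eq Nx Ny \<phi> z1 z2 q r u pt \<longleftrightarrow> (\<forall>\<xi>\<in>W_h Nx Ny.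
     vol_int Nx Ny (\<lambda>i j x y.
         (z1 * r i j x y + z2 * (Phi Nx Ny \<phi> i j x y - r i j x y)) * pt i j x y * \<xi> i j x y)
     = vol_int Nx Ny (\<lambda>i j x y. u i j x y \<bullet> grad \<xi> i j x y)
       + (\<Sum>e\<in>interior_edges Nx Ny. edge_quad Nx Ny e (\<lambda>e \<beta>.
            (u_hat Nx Ny u e \<beta> \<bullet> normal e) * jump Nx Ny \<xi> e \<beta>))
       + vol_quad Nx Ny (\<lambda>i j x y. q x y * \<xi> i j x y))"

definition velocity_eq ::
  "nat \<Rightarrow> nat \<Rightarrow> (real \<Rightarrow> real) \<Rightarrow> (real \<Rightarrow> real \<Rightarrow> real) \<Rightarrow>
   real cellwise \<Rightarrow> real cellwise \<Rightarrow> (real^2) cellwise \<Rightarrow> bool" where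
  "velocity_eq Nx Ny \<mu> \<kappa> c p u \<longleftrightarrow> (\<forall>\<eta>\<in>WW_h Nx Ny.
     vol_int Nx Ny (\<lambda>i j x y. \<mu> (c i j x y) / \<kappa> x y * (u i j x y \<bullet> \<eta> i j x y))
     = vol_int Nx Ny (\<lambda>i j x y. p i j x y * divergence \<eta> i j x y)
       + (\<Sum>e\<in>edges Nx Ny. edge_quad Nx Ny e (\<lambda>e \<beta>.
            p_hat Nx Ny p e \<beta> * jump Nx Ny (\<lambda>i j x y. \<eta> i j x y \<bullet> normal e) e \<beta>)))"

text \<open>The dispersion tensor \<open>D x y v\<close> may depend on the position as well as on the velocity \<open>v\<close>.
  \<open>disp_grad D u v\<close> is the vector field $\mathbf D(\mathbf u)\nabla v$.\<close>

definition disp_grad ::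
  "(real \<Rightarrow> real \<Rightarrow> real^2 \<Rightarrow> real^2^2) \<Rightarrow> (real^2) cellwise \<Rightarrow> real cellwise \<Rightarrow> (real^2) cellwise" where
  "disp_grad D u v i j x y = D x y (u i j x y) *v grad v i j x y"

definition concentration_eq ::
  "nat \<Rightarrow> nat \<Rightarrow> real \<Rightarrow> (real \<Rightarrow> real \<Rightarrow> real) \<Rightarrow> (real \<Rightarrow> real \<Rightarrow> real) \<Rightarrow>
   (real \<Rightarrow> real \<Rightarrow> real^2 \<Rightarrow> real^2^2) \<Rightarrow> real \<Rightarrow> real \<Rightarrow>
   real cellwise \<Rightarrow> real cellwise \<Rightarrow> (real^2) cellwise \<Rightarrow> real cellwise \<Rightarrow> real cellwise \<Rightarrow> bool" where
  "concentration_eq Nx Ny z1 q ct D \<alpha> \<alpha>t r c u pt rt \<longleftrightarrow> (\<forall>\<zeta>\<in>W_h Nx Ny.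
     vol_int Nx Ny (\<lambda>i j x y. rt i j x y * \<zeta> i j x y)
     = vol_int Nx Ny (\<lambda>i j x y.
         (c i j x y *\<^sub>R u i j x y - disp_grad D u c i j x y) \<bullet> grad \<zeta> i j x y)
       + vol_quad Nx Ny (\<lambda>i j x y.
           (ct x y * q x y - r i j x y * z1 * pt i j x y) * \<zeta> i j x y)
       + (\<Sum>e\<in>interior_edges Nx Ny. edge_quad Nx Ny e (\<lambda>e \<beta>.
            (uc_hat Nx Ny \<alpha> u c e \<beta> \<bullet> normal e) * jump Nx Ny \<zeta> e \<beta>))
       - (\<Sum>e\<in>interior_edges Nx Ny. edge_quad Nx Ny e (\<lambda>e \<beta>.
            mean Nx Ny (\<lambda>i j x y. disp_grad D u c i j x y \<bullet> normal e) e \<beta> * jump Nx Ny \<zeta> e \<beta>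
            + mean Nx Ny (\<lambda>i j x y. disp_grad D u \<zeta> i j x y \<bullet> normal e) e \<beta> * jump Nx Ny c e \<beta>
            + \<alpha>t / edge_len Nx Ny e * jump Nx Ny c e \<beta> * jump Nx Ny \<zeta> e \<beta>)))"

text \<open>One forward Euler step from \<open>r\<close> to \<open>r'\<close>; all other quantities are at the old time level.\<close>

definition euler_step ::
  "nat \<Rightarrow> nat \<Rightarrow> (real \<Rightarrow> real \<Rightarrow> real) \<Rightarrow> real \<Rightarrow> real \<Rightarrow> (real \<Rightarrow> real) \<Rightarrow> (real \<Rightarrow> real \<Rightarrow> real) \<Rightarrow>
   (real \<Rightarrow> real \<Rightarrow> real) \<Rightarrow> (real \<Rightarrow> real \<Rightarrow> real) \<Rightarrow> (real \<Rightarrow> real \<Rightarrow> real^2 \<Rightarrow> real^2^2) \<Rightarrow>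
   real \<Rightarrow> real \<Rightarrow> real \<Rightarrow> real cellwise \<Rightarrow> (real^2) cellwise \<Rightarrow> real cellwise \<Rightarrow> real cellwise \<Rightarrow>
   real cellwise \<Rightarrow> bool" where
  "euler_step Nx Ny \<phi> z1 z2 \<mu> \<kappa> q ct D \<alpha> \<alpha>t \<Delta>t p u r pt r' \<longleftrightarrow>
     p \<in> W_h Nx Ny \<and> u \<in> WW_h Nx Ny \<and> r \<in> W_h Nx Ny \<and> pt \<in> W_h Nx Ny \<and> r' \<in> W_h Nx Ny \<and>
     pressure_eq Nx Ny \<phi> z1 z2 q r u pt \<and>
     velocity_eq Nx Ny \<mu> \<kappa> (conc Nx Ny \<phi> r) p u \<and>
     concentration_eq Nx Ny z1 q ct D \<alpha> \<alpha>t r (conc Nx Ny \<phi> r) u pt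
       (\<lambda>i j x y. (r' i j x y - r i j x y) / \<Delta>t)"

text \<open>Quotients that may have a zero denominator are formed in \<^typ>\<open>ereal\<close>, where a positive number
  divided by zero is \<open>\<infinity>\<close>. Maxima over the domain are suprema in \<^typ>\<open>ereal\<close>, so that a condition
  bounding them from above can only hold if they are finite.\<close>

definition Phi_node :: "nat \<Rightarrow> nat \<Rightarrow> (real \<Rightarrow> real \<Rightarrow> real) \<Rightarrow> nat \<Rightarrow> nat \<Rightarrow> real" where
  "Phi_node Nx Ny \<phi> i j = \<phi> (node Nx i) (node Ny j)"

definition Phi_min :: "nat \<Rightarrow> nat \<Rightarrow> (real \<Rightarrow> real \<Rightarrow> real) \<Rightarrow> real" where
  "Phi_min Nx Ny \<phi> = Min ((\<lambda>(i, j). Phi_node Nx Ny \<phi> i j) ` ({0..Nx} \<times> {0..Ny}))"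

definition Phi_cell_min :: "nat \<Rightarrow> nat \<Rightarrow> (real \<Rightarrow> real \<Rightarrow> real) \<Rightarrow> nat \<Rightarrow> nat \<Rightarrow> real" where
  "Phi_cell_min Nx Ny \<phi> i j =
     Min ((\<lambda>(k, l). Phi_node Nx Ny \<phi> k l) ` ({i - 1, i} \<times> {j - 1, j}))"

definition u_max :: "nat \<Rightarrow> nat \<Rightarrow> (real^2) cellwise \<Rightarrow> real" where
  "u_max Nx Ny u = Max (insert 0 (\<Union>i\<in>{1..Nx - 1}. \<Union>j\<in>{1..Ny - 1}. \<Union>\<beta>\<in>{1,2}.
     {trace_plus Nx Ny u (Vert i j) \<beta> $ 1, trace_plus Nx Ny u (Horz i j) \<beta> $ 2}))"

definition B1 :: "nat \<Rightarrow> nat \<Rightarrow> (real \<Rightarrow> real \<Rightarrow> real) \<Rightarrow> real \<Rightarrow> (real^2) cellwise \<Rightarrow> ereal" where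
  "B1 Nx Ny \<phi> \<alpha> u = (INF i\<in>{1..Nx - 1}. INF j\<in>{1..Ny}. INF \<beta>\<in>{1,2}. INF l\<in>{j - 1, j}.
     ereal (Phi_node Nx Ny \<phi> i l) / ereal (\<alpha> - trace_plus Nx Ny u (Vert i j) \<beta> $ 1))"

definition B2 :: "nat \<Rightarrow> nat \<Rightarrow> (real \<Rightarrow> real \<Rightarrow> real) \<Rightarrow> real \<Rightarrow> (real^2) cellwise \<Rightarrow> ereal" where
  "B2 Nx Ny \<phi> \<alpha> u = (INF i\<in>{1..Nx}. INF j\<in>{1..Ny - 1}. INF \<beta>\<in>{1,2}. INF k\<in>{i - 1, i}.
     ereal (Phi_node Nx Ny \<phi> k j) / ereal (\<alpha> - trace_plus Nx Ny u (Horz i j) \<beta> $ 2))"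

definition max_Omega :: "nat \<Rightarrow> nat \<Rightarrow> real cellwise \<Rightarrow> ereal" where
  "max_Omega Nx Ny f =
     (SUP i\<in>{1..Nx}. SUP j\<in>{1..Ny}. SUP (x, y)\<in>cell Nx Ny i j. ereal (f i j x y))"

definition p_max :: "nat \<Rightarrow> nat \<Rightarrow> real cellwise \<Rightarrow> real" where
  "p_max Nx Ny pt = Max (insert 0 (\<Union>i\<in>{1..Nx}. \<Union>j\<in>{1..Ny}. \<Union>\<beta>\<in>{1,2}. \<Union>\<gamma>\<in>{1,2}.
     {pt i j (gauss Nx i \<beta>) (gauss Ny j \<gamma>)}))"

definition q_neg_max :: "nat \<Rightarrow> nat \<Rightarrow> (real \<Rightarrow> real \<Rightarrow> real) \<Rightarrow> nat \<Rightarrow> nat \<Rightarrow> real" where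
  "q_neg_max Nx Ny q i j = Max (insert 0 (\<Union>\<beta>\<in>{1,2}. \<Union>\<gamma>\<in>{1,2}.
     {- q (gauss Nx i \<beta>) (gauss Ny j \<gamma>)}))"

end

theory Submission
  imports Defs
begin

text \<open>The mixture has two components: \<open>r\<close> with concentration \<open>c\<close>, and \<open>w = \<Phi> - r\<close> with concentration
  \<open>v = 1 - c\<close>. The upper bound on the average of \<open>r\<close> is the statement that the average of \<open>w\<close> stays
  nonnegative, so the proof is a positivity proof for the second component.

  Testing the pressure and concentration equations with the indicator of a cell and subtracting them
  gives an equation for the average of \<open>w\<close> (\<open>complement_balance\<close>). For it to have the same form as the
  equation for \<open>r\<close>, two things have to match: the numerical fluxes, since the total flux is linear
  in the concentration and reduces to the flux of the pressure equation at concentration \<open>1\<close>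
  (\<open>total_flux_complement\<close>), and the integrals, since two-point Gauss quadrature is exact for
  products of bilinear functions (\<open>W_h_product_gauss_exact\<close>).

  Positivity is then a matter of accounting. The new average is the old average of \<open>w\<close>, plus sources,
  minus outflow. All terms are expressed through nonnegative values of \<open>v\<close> at corners or Gauss points.
  Values of \<open>v\<close> from neighbouring cells have in total a nonnegative effect, because the penalty parameter
  \<open>\<alpha>t\<close> dominates the dispersion terms and \<open>\<alpha>\<close> dominates the velocity (\<open>edge_outflow_bound\<close>). Values of
  \<open>v\<close> inside the cell reduce the average, and each such loss is a fraction of the old average: at the
  corners \<open>w\<close> is \<open>v\<close> times the porosity, and the time step conditions compare the coefficients with the
  porosity. Compressibility and sinks consume at most \<open>1/6\<close> each, convection through the four edges
  at most \<open>1/3\<close>, and dispersion together with the penalty at most \<open>1/12\<close> in either direction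
  (\<open>cell_outflow_budget\<close>). The losses add up to at most \<open>5/6\<close> of the old average.\<close>

section \<open>The uniform mesh and two-point Gauss quadrature\<close>
lemma node_Suc: "node N (Suc i) = node N i + mesh_size N"
  by (simp add: node_def algebra_simps)

lemma mesh_size_pos: "N \<ge> 1 \<Longrightarrow> mesh_size N > 0"
  by (simp add: mesh_size_def)

lemma node_pred: "i \<ge> 1 \<Longrightarrow> node N i = node N (i - 1) + mesh_size N"
  by (cases i) (simp_all add: node_Suc)

lemma node_bounds:
  assumes "N \<ge> 1" "i \<le> N" shows "node N i \<in> {0..2*pi}"
proof -
  have "real i * (2 * pi / real N) \<le> real N * (2 * pi / real N)"
    using assms by (intro mult_right_mono) auto
  then show ?thesis using assms by (simp add: node_def mesh_size_def)
qed

text \<open>Relative to the left node of its cell, a Gauss point lies at a fixed fraction of the cell width,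
  so its position, the sum and the difference of the two points follow by linear arithmetic.\<close>
lemma gauss_eq:
  "i \<ge> 1 \<Longrightarrow> gauss N i \<beta> = node N (i - 1) + (1 + (if \<beta> = 1 then - 1 else 1) / sqrt 3) / 2 * mesh_size N"
  by (cases i) (simp_all add: gauss_def node_def algebra_simps add_divide_distrib diff_divide_distrib)

lemma gauss_between:
  assumes "N \<ge> 1" "i \<ge> 1"
  shows "gauss N i \<beta> \<in> {node N (i - 1)<..<node N i}"
proof -
  have h: "mesh_size N > 0" using assms(1) by (rule mesh_size_pos)
  define t :: real where "t = (if \<beta> = 1 then - 1 else 1) / sqrt 3"
  have "\<bar>t\<bar> < 1" by (simp add: t_def abs_divide)
  then have s: "(1 + t) / 2 > 0" "(1 + t) / 2 < 1" by auto
  show ?thesis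
    unfolding gauss_eq[OF assms(2)] t_def[symmetric] using node_pred[OF assms(2), of N] mult_pos_pos[OF s(1) h]
      mult_strict_right_mono[OF s(2) h] by simp
qed

text \<open>With midpoint \<open>m\<close>, width \<open>h\<close> and Gauss points \<open>m \<plusminus> s h / 2\<close>, the quadrature of \<open>x\<^sup>2\<close> is
  \<open>h (m\<^sup>2 + s\<^sup>2 h\<^sup>2 / 4)\<close>, which is the integral \<open>h (m\<^sup>2 + h\<^sup>2 / 12)\<close> because \<open>s\<^sup>2 = 1/3\<close>.\<close>
lemma gauss_exact_quadratic:
  assumes N: "N \<ge> 1" "i \<ge> 1"
  shows "integral {node N (i - 1)..node N i} (\<lambda>x. A + B * x + C * x\<^sup>2)
    = mesh_size N / 2 * (\<Sum>\<beta>\<in>{1,2}. A + B * gauss N i \<beta> + C * (gauss N i \<beta>)\<^sup>2)"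
proof -
  define a h s where "a = node N (i - 1)" and "h = mesh_size N" and "s = 1 / sqrt 3"
  let ?F = "\<lambda>x. A * x + B * x\<^sup>2 / 2 + C * x ^ 3 / 3"
  have b: "node N i = a + h" using node_pred[of i N] N by (simp add: a_def h_def)
  have "h > 0" using mesh_size_pos[OF N(1)] by (simp add: h_def)
  then have "((\<lambda>x. A + B * x + C * x\<^sup>2) has_integral ?F (a + h) - ?F a) {a..a + h}"
    by (intro fundamental_theorem_of_calculus)
      (auto intro!: derivative_eq_intros simp flip: has_real_derivative_iff_has_vector_derivative)
  then have I: "integral {node N (i - 1)..node N i} (\<lambda>x. A + B * x + C * x\<^sup>2) = ?F (a + h) - ?F a"
    unfolding b a_def[symmetric] by (rule integral_unique)
  have s2: "s\<^sup>2 = 1 / 3" by (simp add: s_def power_divide)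
  have g: "gauss N i 1 = a + h / 2 - s * h / 2" "gauss N i 2 = a + h / 2 + s * h / 2"
    using gauss_eq[OF N(2), of N 1] gauss_eq[OF N(2), of N 2]
    by (simp_all add: s_def a_def h_def algebra_simps diff_divide_distrib add_divide_distrib)
  have "h / 2 * ((A + B * (a + h / 2 - s * h / 2) + C * (a + h / 2 - s * h / 2)\<^sup>2)
      + (A + B * (a + h / 2 + s * h / 2) + C * (a + h / 2 + s * h / 2)\<^sup>2))
    = h * (A + B * (a + h / 2) + C * (a + h / 2)\<^sup>2) + C * h ^ 3 * s\<^sup>2 / 4"
    by (simp add: field_simps power2_eq_square power3_eq_cube)
  also have "\<dots> = ?F (a + h) - ?F a"
    unfolding s2 by (simp add: field_simps power2_eq_square power3_eq_cube)
  finally show ?thesis unfolding I by (simp add: g[simplified] h_def)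
qed

lemma gauss_sum: "i \<ge> 1 \<Longrightarrow> gauss N i 1 + gauss N i 2 = node N (i - 1) + node N i"
  using node_pred[of i N] by (simp add: gauss_eq algebra_simps add_divide_distrib diff_divide_distrib)

lemma gauss_diff: "i \<ge> 1 \<Longrightarrow> sqrt 3 * (gauss N i 2 - gauss N i 1) = node N i - node N (i - 1)"
  using node_pred[of i N] by (simp add: gauss_eq algebra_simps add_divide_distrib diff_divide_distrib)

lemma cell_cbox: "cell Nx Ny i j = cbox (node Nx (i - 1), node Ny (j - 1)) (node Nx i, node Ny j)"
  by (simp add: cell_def cbox_Pair_eq)

lemma gauss_in_cell:
  assumes "Nx \<ge> 1" "Ny \<ge> 1" "i \<ge> 1" "j \<ge> 1"
  shows "(gauss Nx i \<beta>, gauss Ny j \<gamma>) \<in> interior (cell Nx Ny i j)"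
  using gauss_between[of Nx i \<beta>] gauss_between[of Ny j \<gamma>] assms
  by (auto simp: cell_def interior_Times)

definition cell_quad :: "nat \<Rightarrow> nat \<Rightarrow> nat \<Rightarrow> nat \<Rightarrow> (real \<Rightarrow> real \<Rightarrow> real) \<Rightarrow> real" where
  "cell_quad Nx Ny i j f = (\<Sum>\<beta>\<in>{1,2}. \<Sum>\<gamma>\<in>{1,2}. f (gauss Nx i \<beta>) (gauss Ny j \<gamma>)) / 4"

text \<open>By Fubini the one-dimensional rule applies in each variable separately, so it is enough that \<open>f\<close>
  is quadratic in either variable while the other is held fixed.\<close>
lemma gauss_exact_cell:
  assumes N: "Nx \<ge> 1" "Ny \<ge> 1" "i \<ge> 1" "j \<ge> 1"
    and cont: "continuous_on UNIV (\<lambda>(x, y). f x y)"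
    and qx: "\<And>y. \<exists>A B C. \<forall>x. f x y = A + B * x + C * x\<^sup>2"
    and qy: "\<And>x. \<exists>A B C. \<forall>y. f x y = A + B * y + C * y\<^sup>2"
  shows "integral (cell Nx Ny i j) (\<lambda>(x, y). f x y) = mesh_size Nx * mesh_size Ny * cell_quad Nx Ny i j f"
proof -
  have inner: "integral {node Ny (j - 1)..node Ny j} (f x)
      = mesh_size Ny / 2 * (\<Sum>\<gamma>\<in>{1,2}. f x (gauss Ny j \<gamma>))" for x
  proof -
    obtain A B C where f: "\<And>y. f x y = A + B * y + C * y\<^sup>2" using qy[of x] by auto
    show ?thesis using gauss_exact_quadratic[OF N(2,4), of A B C] by (simp flip: f)
  qed
  have outer: "integral {node Nx (i - 1)..node Nx i} (\<lambda>x. f x y)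
      = mesh_size Nx / 2 * (\<Sum>\<beta>\<in>{1,2}. f (gauss Nx i \<beta>) y)" for y
  proof -
    obtain A B C where f: "\<And>x. f x y = A + B * x + C * x\<^sup>2" using qx[of y] by auto
    show ?thesis using gauss_exact_quadratic[OF N(1,3), of A B C] by (simp flip: f)
  qed
  have int: "(\<lambda>x. f x y) integrable_on {node Nx (i - 1)..node Nx i}" for y
  proof -
    obtain A B C where f: "\<And>x. f x y = A + B * x + C * x\<^sup>2" using qx[of y] by auto
    show ?thesis unfolding f by (intro integrable_continuous_real continuous_intros)
  qed
  have "integral (cell Nx Ny i j) (\<lambda>(x, y). f x y)
      = integral {node Nx (i - 1)..node Nx i} (\<lambda>x. integral {node Ny (j - 1)..node Ny j} (f x))"
    unfolding cell_cbox using integral_prod_continuous[OF continuous_on_subset[OF cont subset_UNIV]]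
    by simp
  also have "\<dots> = mesh_size Ny / 2 *
      (\<Sum>\<gamma>\<in>{1,2}. integral {node Nx (i - 1)..node Nx i} (\<lambda>x. f x (gauss Ny j \<gamma>)))"
    unfolding inner using integral_add[OF int int] by simp
  also have "\<dots> = mesh_size Nx * mesh_size Ny * cell_quad Nx Ny i j f"
    unfolding outer by (simp add: cell_quad_def field_simps)
  finally show ?thesis .
qed

section \<open>Piecewise bilinear functions\<close>
lemma W_h_cellE:
  assumes "v \<in> W_h Nx Ny" "i \<in> {1..Nx}" "j \<in> {1..Ny}"
  obtains a b c d where "v i j = (\<lambda>x y. a + b * x + c * y + d * x * y)"
proof -
  have "\<exists>a b c d. \<forall>x y. v i j x y = a + b * x + c * y + d * x * y"
    using assms by (simp add: W_h_def)
  then obtain a b c d where "\<forall>x y. v i j x y = a + b * x + c * y + d * x * y" by (elim exE)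
  then show ?thesis by (intro that) (rule ext, rule ext, elim allE)
qed

lemma W_h_cellI:
  assumes "\<And>i j. i \<in> {1..Nx} \<Longrightarrow> j \<in> {1..Ny} \<Longrightarrow> \<exists>a b c d. v i j = (\<lambda>x y. a + b * x + c * y + d * x * y)"
  shows "v \<in> W_h Nx Ny"
  using assms unfolding W_h_def fun_eq_iff mem_Collect_eq by (intro ballI)

lemma W_h_const: "(\<lambda>i j x y. k i j) \<in> W_h Nx Ny"
proof (rule W_h_cellI)
  fix i j
  show "\<exists>a b c d. (\<lambda>x y. k i j) = (\<lambda>x y. a + b * x + c * y + d * x * y)"
    by (intro exI[of _ "k i j"] exI[of _ 0]) simp
qed

text \<open>The factor \<open>k\<close> makes this one closure property cover sums, scalar multiples and differences.\<close>
lemma W_h_diff: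
  assumes "v \<in> W_h Nx Ny" "w \<in> W_h Nx Ny"
  shows "(\<lambda>i j x y. v i j x y - k * w i j x y) \<in> W_h Nx Ny"
proof (rule W_h_cellI)
  fix i j assume ij: "i \<in> {1..Nx}" "j \<in> {1..Ny}"
  obtain a b c d where v: "v i j = (\<lambda>x y. a + b * x + c * y + d * x * y)"
    using W_h_cellE[OF assms(1) ij] .
  obtain a' b' c' d' where w: "w i j = (\<lambda>x y. a' + b' * x + c' * y + d' * x * y)"
    using W_h_cellE[OF assms(2) ij] .
  show "\<exists>a b c d. (\<lambda>x y. v i j x y - k * w i j x y) = (\<lambda>x y. a + b * x + c * y + d * x * y)"
    unfolding v w
    by (intro exI[of _ "a - k * a'"] exI[of _ "b - k * b'"] exI[of _ "c - k * c'"] exI[of _ "d - k * d'"])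
      (simp add: algebra_simps)
qed

lemma interp_in_W_h: "interp Nx Ny g \<in> W_h Nx Ny"
proof (rule W_h_cellI)
  fix i j
  define xl xr yb yt H where "xl = node Nx (i - 1)" and "xr = node Nx i"
    and "yb = node Ny (j - 1)" and "yt = node Ny j" and "H = mesh_size Nx * mesh_size Ny"
  define g1 g2 g3 g4 where "g1 = g i j xl yb" and "g2 = g i j xr yb" and "g3 = g i j xl yt" and "g4 = g i j xr yt"
  have e: "interp Nx Ny g i j = (\<lambda>x y. (g1 * (xr - x) * (yt - y) + g2 * (x - xl) * (yt - y)
         + g3 * (xr - x) * (y - yb) + g4 * (x - xl) * (y - yb)) / H)"
    by (simp add: interp_def Let_def fun_eq_iff xl_def xr_def yb_def yt_def H_def g1_def g2_def g3_def g4_def)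
  show "\<exists>a b c d. interp Nx Ny g i j = (\<lambda>x y. a + b * x + c * y + d * x * y)"
    unfolding e
    by (intro exI[of _ "(g1 * xr * yt - g2 * xl * yt - g3 * xr * yb + g4 * xl * yb) / H"]
        exI[of _ "(g2 * yt - g1 * yt + g3 * yb - g4 * yb) / H"]
        exI[of _ "(g2 * xl - g1 * xr + g3 * xr - g4 * xl) / H"]
        exI[of _ "(g1 - g2 - g3 + g4) / H"] ext)
      (simp add: divide_inverse algebra_simps)
qed

lemma interp_at_corner:
  assumes N: "Nx \<ge> 1" "Ny \<ge> 1" "i \<ge> 1" "j \<ge> 1" and "k \<in> {i - 1, i}" "l \<in> {j - 1, j}"
  shows "interp Nx Ny g i j (node Nx k) (node Ny l) = g i j (node Nx k) (node Ny l)"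
proof -
  have "node Nx i - node Nx (i - 1) = mesh_size Nx" "node Ny j - node Ny (j - 1) = mesh_size Ny"
    using node_pred[of i Nx] node_pred[of j Ny] N by auto
  then show ?thesis using assms mesh_size_pos[of Nx] mesh_size_pos[of Ny]
    by (auto simp: interp_def Let_def)
qed

text \<open>At each point of the cell a bilinear function is a convex combination of its four corner values,
  with the products of the barycentric coordinates in \<open>x\<close> and \<open>y\<close> as weights.\<close>
lemma W_h_nonneg_if_corners:
  assumes v: "v \<in> W_h Nx Ny" and ij: "i \<in> {1..Nx}" "j \<in> {1..Ny}"
    and corner: "\<And>k l. k \<in> {i - 1, i} \<Longrightarrow> l \<in> {j - 1, j} \<Longrightarrow> v i j (node Nx k) (node Ny l) \<ge> 0"
    and xy: "(x, y) \<in> cell Nx Ny i j"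
  shows "v i j x y \<ge> 0"
proof -
  obtain a b c d where e: "v i j = (\<lambda>x y. a + b * x + c * y + d * x * y)" using W_h_cellE[OF v ij] .
  define xl xr yb yt where "xl = node Nx (i - 1)" and "xr = node Nx i"
    and "yb = node Ny (j - 1)" and "yt = node Ny j"
  have h: "xr - xl > 0" "yt - yb > 0"
    using node_pred[of i Nx] node_pred[of j Ny] mesh_size_pos[of Nx] mesh_size_pos[of Ny] ij
    by (auto simp: xl_def xr_def yb_def yt_def)
  have xy': "xl \<le> x" "x \<le> xr" "yb \<le> y" "y \<le> yt"
    using xy by (auto simp: cell_def xl_def xr_def yb_def yt_def)
  have c: "v i j xl yb \<ge> 0" "v i j xr yb \<ge> 0" "v i j xl yt \<ge> 0" "v i j xr yt \<ge> 0"
    using corner by (auto simp: xl_def xr_def yb_def yt_def)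
  have "(xr - xl) * (yt - yb) * v i j x y = v i j xl yb * (xr - x) * (yt - y) + v i j xr yb * (x - xl) * (yt - y)
         + v i j xl yt * (xr - x) * (y - yb) + v i j xr yt * (x - xl) * (y - yb)"
    unfolding e by algebra
  also have "\<dots> \<ge> 0" using c xy' by (intro add_nonneg_nonneg mult_nonneg_nonneg) auto
  finally show ?thesis using mult_pos_pos[OF h] by (simp add: zero_le_mult_iff)
qed

text \<open>On a segment parallel to an axis a bilinear function is affine. Gauss values and end values
  therefore have the same sum, because the Gauss points are symmetric about the midpoint, while
  their differences are in the ratio of the distances, \<open>1 : sqrt 3\<close>. This is how traces at the
  Gauss points of an edge are exchanged for corner values.\<close>
lemma W_h_gauss_sum_x:
  assumes "v \<in> W_h Nx Ny" "i \<in> {1..Nx}" "j \<in> {1..Ny}"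
  shows "v i j (gauss Nx i 1) y + v i j (gauss Nx i 2) y = v i j (node Nx (i - 1)) y + v i j (node Nx i) y"
proof -
  obtain a b c d where e: "v i j = (\<lambda>x y. a + b * x + c * y + d * x * y)" using W_h_cellE[OF assms] .
  show ?thesis unfolding e using gauss_sum[of i Nx] assms(2) by simp algebra
qed

lemma W_h_gauss_sum_y:
  assumes "v \<in> W_h Nx Ny" "i \<in> {1..Nx}" "j \<in> {1..Ny}"
  shows "v i j x (gauss Ny j 1) + v i j x (gauss Ny j 2) = v i j x (node Ny (j - 1)) + v i j x (node Ny j)"
proof -
  obtain a b c d where e: "v i j = (\<lambda>x y. a + b * x + c * y + d * x * y)" using W_h_cellE[OF assms] .
  show ?thesis unfolding e using gauss_sum[of j Ny] assms(3) by simp algebra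
qed

lemma W_h_gauss_diff_y:
  assumes "v \<in> W_h Nx Ny" "i \<in> {1..Nx}" "j \<in> {1..Ny}"
  shows "sqrt 3 * (v i j x (gauss Ny j 2) - v i j x (gauss Ny j 1)) = v i j x (node Ny j) - v i j x (node Ny (j - 1))"
proof -
  obtain a b c d where e: "v i j = (\<lambda>x y. a + b * x + c * y + d * x * y)" using W_h_cellE[OF assms] .
  show ?thesis unfolding e using gauss_diff[of j Ny] assms(3) by simp algebra
qed

lemma W_h_grad:
  assumes "v \<in> W_h Nx Ny" "i \<in> {1..Nx}" "j \<in> {1..Ny}"
  shows "grad v i j x y $ 1 = (v i j (node Nx i) y - v i j (node Nx (i - 1)) y) / mesh_size Nx"
    and "grad v i j x y $ 2 = (v i j x (node Ny j) - v i j x (node Ny (j - 1))) / mesh_size Ny"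
proof -
  obtain a b c d where e: "v i j = (\<lambda>x y. a + b * x + c * y + d * x * y)" using W_h_cellE[OF assms] .
  have "deriv (\<lambda>s. v i j s y) x = b + d * y" "deriv (\<lambda>s. v i j x s) y = c + d * x"
    unfolding e by (rule DERIV_imp_deriv, auto intro!: derivative_eq_intros)+
  then have g: "grad v i j x y $ 1 = b + d * y" "grad v i j x y $ 2 = c + d * x"
    by (simp_all add: grad_def)
  have n: "node Nx i = node Nx (i - 1) + mesh_size Nx" "node Ny j = node Ny (j - 1) + mesh_size Ny"
    using node_pred[of i Nx] node_pred[of j Ny] assms(2,3) by auto
  have h: "mesh_size Nx > 0" "mesh_size Ny > 0"
    using mesh_size_pos[of Nx] mesh_size_pos[of Ny] assms(2,3) by auto
  show "grad v i j x y $ 1 = (v i j (node Nx i) y - v i j (node Nx (i - 1)) y) / mesh_size Nx"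
    unfolding g e n using h by (simp add: field_simps)
  show "grad v i j x y $ 2 = (v i j x (node Ny j) - v i j x (node Ny (j - 1))) / mesh_size Ny"
    unfolding g e n using h by (simp add: field_simps)
qed

text \<open>The pressure equation contains the exact integral of \<open>r p\<^sub>t\<close>, the concentration equation its
  quadrature. The two can be subtracted from each other because a product of two bilinear functions
  is biquadratic, hence integrated exactly.\<close>
lemma W_h_product_gauss_exact:
  assumes v: "v \<in> W_h Nx Ny" "w \<in> W_h Nx Ny" and ij: "i \<in> {1..Nx}" "j \<in> {1..Ny}"
  shows "integral (cell Nx Ny i j) (\<lambda>(x, y). v i j x y * w i j x y)
    = mesh_size Nx * mesh_size Ny * cell_quad Nx Ny i j (\<lambda>x y. v i j x y * w i j x y)"
proof -
  obtain a b c d where v: "v i j = (\<lambda>x y. a + b * x + c * y + d * x * y)"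
    using W_h_cellE[OF v(1) ij] .
  obtain a' b' c' d' where w: "w i j = (\<lambda>x y. a' + b' * x + c' * y + d' * x * y)"
    using W_h_cellE[OF assms(2) ij] .
  show ?thesis unfolding v w
  proof (rule gauss_exact_cell)
    show "\<exists>A B C. \<forall>x. (a + b * x + c * y + d * x * y) * (a' + b' * x + c' * y + d' * x * y) = A + B * x + C * x\<^sup>2" for y
      by (intro exI[of _ "(a + c * y) * (a' + c' * y)"] exI[of _ "(b + d * y) * (b' + d' * y)"]
          exI[of _ "(a + c * y) * (b' + d' * y) + (a' + c' * y) * (b + d * y)"])
        (simp add: power2_eq_square algebra_simps)
    show "\<exists>A B C. \<forall>y. (a + b * x + c * y + d * x * y) * (a' + b' * x + c' * y + d' * x * y) = A + B * y + C * y\<^sup>2" for x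
      by (intro exI[of _ "(a + b * x) * (a' + b' * x)"] exI[of _ "(c + d * x) * (c' + d' * x)"]
          exI[of _ "(a + b * x) * (c' + d' * x) + (a' + b' * x) * (c + d * x)"])
        (simp add: power2_eq_square algebra_simps)
  qed (use ij in \<open>auto simp: case_prod_unfold intro!: continuous_intros\<close>)
qed

lemma W_h_gauss_exact:
  assumes "v \<in> W_h Nx Ny" "i \<in> {1..Nx}" "j \<in> {1..Ny}"
  shows "integral (cell Nx Ny i j) (\<lambda>(x, y). v i j x y)
    = mesh_size Nx * mesh_size Ny * cell_quad Nx Ny i j (v i j)"
  using W_h_product_gauss_exact[OF assms(1) W_h_const[where k = "\<lambda>i j. 1"] assms(2,3)]
  by (simp add: cell_quad_def)

lemma cell_quad_corners:
  assumes "v \<in> W_h Nx Ny" "i \<in> {1..Nx}" "j \<in> {1..Ny}"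
  shows "cell_quad Nx Ny i j (v i j) =
    (v i j (node Nx (i - 1)) (node Ny (j - 1)) + v i j (node Nx i) (node Ny (j - 1))
     + v i j (node Nx (i - 1)) (node Ny j) + v i j (node Nx i) (node Ny j)) / 4"
proof -
  have "4 * cell_quad Nx Ny i j (v i j)
    = (v i j (gauss Nx i 1) (gauss Ny j 1) + v i j (gauss Nx i 1) (gauss Ny j 2))
    + (v i j (gauss Nx i 2) (gauss Ny j 1) + v i j (gauss Nx i 2) (gauss Ny j 2))"
    by (simp add: cell_quad_def)
  also have "\<dots> = (v i j (gauss Nx i 1) (node Ny (j - 1)) + v i j (gauss Nx i 2) (node Ny (j - 1)))
    + (v i j (gauss Nx i 1) (node Ny j) + v i j (gauss Nx i 2) (node Ny j))"
    unfolding W_h_gauss_sum_y[OF assms] by simp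
  finally show ?thesis unfolding W_h_gauss_sum_x[OF assms] by simp
qed

section \<open>Balance of a single cell\<close>
definition cell_indicator :: "nat \<Rightarrow> nat \<Rightarrow> real cellwise" where
  "cell_indicator k l i j x y = (if i = k \<and> j = l then 1 else 0)"

definition net_inflow :: "nat \<Rightarrow> nat \<Rightarrow> (edge \<Rightarrow> nat \<Rightarrow> real) \<Rightarrow> nat \<Rightarrow> nat \<Rightarrow> real" where
  "net_inflow Nx Ny F i j =
     edge_quad Nx Ny (Vert (i - 1) j) F - edge_quad Nx Ny (Vert i j) F
     + edge_quad Nx Ny (Horz i (j - 1)) F - edge_quad Nx Ny (Horz i j) F"

text \<open>The complete numerical flux of a concentration \<open>v\<close>: convection, averaged dispersion and
  interior penalty.\<close>
definition total_flux ::
  "nat \<Rightarrow> nat \<Rightarrow> (real \<Rightarrow> real \<Rightarrow> real^2 \<Rightarrow> real^2^2) \<Rightarrow> real \<Rightarrow> real \<Rightarrow>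
   (real^2) cellwise \<Rightarrow> real cellwise \<Rightarrow> edge \<Rightarrow> nat \<Rightarrow> real" where
  "total_flux Nx Ny D \<alpha> \<alpha>t u v e \<beta> = uc_hat Nx Ny \<alpha> u v e \<beta> \<bullet> normal e
     - mean Nx Ny (\<lambda>i j x y. disp_grad D u v i j x y \<bullet> normal e) e \<beta>
     - \<alpha>t / edge_len Nx Ny e * jump Nx Ny v e \<beta>"

lemma interior_edges_Vert: "Vert i j \<in> interior_edges Nx Ny \<longleftrightarrow> i \<in> {1..<Nx} \<and> j \<in> {1..Ny}"
  by (auto simp: interior_edges_def edges_def)

lemma interior_edges_Horz: "Horz i j \<in> interior_edges Nx Ny \<longleftrightarrow> i \<in> {1..Nx} \<and> j \<in> {1..<Ny}"
  by (auto simp: interior_edges_def edges_def)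

lemma finite_interior_edges: "finite (interior_edges Nx Ny)"
  by (simp add: interior_edges_def edges_def)

lemma inner_normal [simp]: "v \<bullet> normal (Vert i j) = v $ 1" "v \<bullet> normal (Horz i j) = v $ 2"
  by (simp_all add: inner_vec_def sum_2)

lemma cell_indicator_in_W_h: "cell_indicator k l \<in> W_h Nx Ny"
  unfolding cell_indicator_def [abs_def] by (rule W_h_const)

text \<open>For a test function that is constant on each cell, this removes the volume flux terms and the
  symmetrisation term of the interior penalty method.\<close>
lemma grad_cell_indicator: "grad (cell_indicator k l) i j x y = 0"
  by (simp add: grad_def cell_indicator_def vec_eq_iff forall_2)

lemma mean_disp_grad_cell_indicator:
  "mean Nx Ny (\<lambda>i j x y. disp_grad D u (cell_indicator k l) i j x y \<bullet> n) e \<beta> = 0"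
  by (cases e) (simp_all add: mean_def branch_def disp_grad_def grad_cell_indicator)

lemma jump_cell_indicator_Vert:
  assumes "k \<in> {1..<Nx}" "l \<in> {1..Ny}" "i \<ge> 1"
  shows "jump Nx Ny (cell_indicator i j) (Vert k l) \<beta>
    = (if k = i - 1 \<and> l = j then 1 else 0) - (if k = i \<and> l = j then 1 else 0)"
proof -
  have "k + 1 = i \<longleftrightarrow> k = i - 1" using assms(3) by linarith
  then show ?thesis using assms by (simp add: jump_def branch_def cell_indicator_def)
qed

lemma jump_cell_indicator_Horz:
  assumes "k \<in> {1..Nx}" "l \<in> {1..<Ny}" "j \<ge> 1"
  shows "jump Nx Ny (cell_indicator i j) (Horz k l) \<beta>
    = (if k = i \<and> l = j - 1 then 1 else 0) - (if k = i \<and> l = j then 1 else 0)"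
proof -
  have "l + 1 = j \<longleftrightarrow> l = j - 1" using assms(3) by linarith
  then show ?thesis using assms by (simp add: jump_def branch_def cell_indicator_def)
qed

text \<open>The indicator jumps by \<open>1\<close> on the left and bottom edges of its cell, where the cell lies on the
  plus side, by \<open>-1\<close> on the right and top edges, and nowhere else. Since the cell is away from the
  boundary, these four edges are all interior.\<close>
lemma sum_interior_edges_cell_indicator:
  assumes ij: "i \<in> {2..Nx - 1}" "j \<in> {2..Ny - 1}"
  shows "(\<Sum>e\<in>interior_edges Nx Ny. edge_quad Nx Ny e (\<lambda>e \<beta>. F e \<beta> * jump Nx Ny (cell_indicator i j) e \<beta>))
    = net_inflow Nx Ny F i j"
proof -
  let ?S = "{Vert (i - 1) j, Vert i j, Horz i (j - 1), Horz i j}"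
  let ?t = "\<lambda>e. edge_quad Nx Ny e (\<lambda>e \<beta>. F e \<beta> * jump Nx Ny (cell_indicator i j) e \<beta>)"
  have ij1: "i \<ge> 1" "j \<ge> 1" "i - 1 \<noteq> i" "j - 1 \<noteq> j" using ij by auto
  have sub: "?S \<subseteq> interior_edges Nx Ny"
    using ij by (auto simp: interior_edges_Vert interior_edges_Horz)
  have zero: "?t e = 0" if "e \<in> interior_edges Nx Ny - ?S" for e
  proof (cases e)
    case (Vert k l)
    then have "k \<in> {1..<Nx}" "l \<in> {1..Ny}" "\<not> (k = i - 1 \<and> l = j)" "\<not> (k = i \<and> l = j)"
      using that interior_edges_Vert by blast+
    then show ?thesis using ij1 unfolding Vert edge_quad_def
      by (simp only: jump_cell_indicator_Vert) simp
  next
    case (Horz k l)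
    then have "k \<in> {1..Nx}" "l \<in> {1..<Ny}" "\<not> (k = i \<and> l = j - 1)" "\<not> (k = i \<and> l = j)"
      using that interior_edges_Horz by blast+
    then show ?thesis using ij1 unfolding Horz edge_quad_def
      by (simp only: jump_cell_indicator_Horz) simp
  qed
  have "(\<Sum>e\<in>interior_edges Nx Ny. ?t e) = sum ?t ?S"
    by (rule sum.mono_neutral_right[OF finite_interior_edges sub]) (use zero in blast)
  also have "\<dots> = ?t (Vert (i - 1) j) + ?t (Vert i j) + ?t (Horz i (j - 1)) + ?t (Horz i j)"
    using ij1(3,4) by simp
  also have "\<dots> = net_inflow Nx Ny F i j"
  proof -
    have "i - 1 \<in> {1..<Nx}" "i \<in> {1..<Nx}" "j \<in> {1..Ny}" "i \<in> {1..Nx}" "j - 1 \<in> {1..<Ny}" "j \<in> {1..<Ny}"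
      using ij by auto
    then show ?thesis using ij1
      by (simp add: net_inflow_def edge_quad_def jump_cell_indicator_Vert jump_cell_indicator_Horz
          del: One_nat_def atLeastLessThan_iff atLeastAtMost_iff) (simp add: algebra_simps add_divide_distrib diff_divide_distrib)
  qed
  finally show ?thesis .
qed

lemma sum_cells_cell_indicator:
  fixes f :: "nat \<Rightarrow> nat \<Rightarrow> real"
  assumes "k \<in> {1..Nx}" "l \<in> {1..Ny}" and "\<And>i j. \<not> (i = k \<and> j = l) \<Longrightarrow> f i j = 0"
  shows "(\<Sum>i=1..Nx. \<Sum>j=1..Ny. f i j) = f k l"
proof -
  have "(\<Sum>j=1..Ny. f i j) = (if i = k then f k l else 0)" for i
  proof (cases "i = k")
    case True
    then have "(\<Sum>j=1..Ny. f i j) = (\<Sum>j=1..Ny. if j = l then f k l else 0)"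
      using assms(3) by (intro sum.cong) auto
    then show ?thesis using assms(2) True by simp
  qed (use assms(3) in simp)
  then show ?thesis using assms(1) by simp
qed

lemma vol_int_cell_indicator:
  assumes "k \<in> {1..Nx}" "l \<in> {1..Ny}"
  shows "vol_int Nx Ny (\<lambda>i j x y. f i j x y * cell_indicator k l i j x y)
    = integral (cell Nx Ny k l) (\<lambda>(x, y). f k l x y)"
  unfolding vol_int_def
  by (subst sum_cells_cell_indicator[OF assms]) (auto simp: cell_indicator_def case_prod_unfold)

lemma vol_quad_cell_indicator:
  assumes "k \<in> {1..Nx}" "l \<in> {1..Ny}"
  shows "vol_quad Nx Ny (\<lambda>i j x y. f i j x y * cell_indicator k l i j x y)
    = mesh_size Nx * mesh_size Ny * cell_quad Nx Ny k l (f k l)"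
  unfolding vol_quad_def
  by (subst sum_cells_cell_indicator[OF assms]) (auto simp: cell_indicator_def cell_quad_def)

lemma pressure_balance:
  assumes "pressure_eq Nx Ny \<phi> z1 z2 q r u pt" and ij: "i \<in> {2..Nx - 1}" "j \<in> {2..Ny - 1}"
  shows "integral (cell Nx Ny i j)
      (\<lambda>(x, y). (z1 * r i j x y + z2 * (Phi Nx Ny \<phi> i j x y - r i j x y)) * pt i j x y)
    = net_inflow Nx Ny (\<lambda>e \<beta>. u_hat Nx Ny u e \<beta> \<bullet> normal e) i j
      + mesh_size Nx * mesh_size Ny * cell_quad Nx Ny i j q"
proof -
  have ij': "i \<in> {1..Nx}" "j \<in> {1..Ny}" using ij by auto
  show ?thesis
    using assms(1)[unfolded pressure_eq_def, rule_format, OF cell_indicator_in_W_h[of i j]]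
    unfolding sum_interior_edges_cell_indicator[OF ij] vol_int_cell_indicator[OF ij']
      vol_quad_cell_indicator[OF ij'] grad_cell_indicator
    by (simp add: vol_int_def case_prod_unfold)
qed

lemma concentration_balance:
  assumes "concentration_eq Nx Ny z1 q ct D \<alpha> \<alpha>t r c u pt rt" and ij: "i \<in> {2..Nx - 1}" "j \<in> {2..Ny - 1}"
  shows "integral (cell Nx Ny i j) (\<lambda>(x, y). rt i j x y)
    = net_inflow Nx Ny (total_flux Nx Ny D \<alpha> \<alpha>t u c) i j
      + mesh_size Nx * mesh_size Ny *
        cell_quad Nx Ny i j (\<lambda>x y. ct x y * q x y - r i j x y * z1 * pt i j x y)"
proof -
  have ij': "i \<in> {1..Nx}" "j \<in> {1..Ny}" using ij by auto
  let ?I = "cell_indicator i j"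
  have "(\<Sum>e\<in>interior_edges Nx Ny. edge_quad Nx Ny e (\<lambda>e \<beta>.
            mean Nx Ny (\<lambda>i j x y. disp_grad D u c i j x y \<bullet> normal e) e \<beta> * jump Nx Ny ?I e \<beta>
            + mean Nx Ny (\<lambda>i j x y. disp_grad D u ?I i j x y \<bullet> normal e) e \<beta> * jump Nx Ny c e \<beta>
            + \<alpha>t / edge_len Nx Ny e * jump Nx Ny c e \<beta> * jump Nx Ny ?I e \<beta>))
    = (\<Sum>e\<in>interior_edges Nx Ny. edge_quad Nx Ny e (\<lambda>e \<beta>.
            (mean Nx Ny (\<lambda>i j x y. disp_grad D u c i j x y \<bullet> normal e) e \<beta>
            + \<alpha>t / edge_len Nx Ny e * jump Nx Ny c e \<beta>) * jump Nx Ny ?I e \<beta>))"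
    unfolding mean_disp_grad_cell_indicator by (simp add: algebra_simps)
  then show ?thesis
    using assms(1)[unfolded concentration_eq_def, rule_format, OF cell_indicator_in_W_h[of i j]]
    unfolding sum_interior_edges_cell_indicator[OF ij] vol_int_cell_indicator[OF ij']
      vol_quad_cell_indicator[OF ij'] grad_cell_indicator
    by (simp add: vol_int_def case_prod_unfold net_inflow_def edge_quad_def total_flux_def algebra_simps)
qed

text \<open>The total flux is linear in the concentration, and for the constant concentration \<open>1\<close> it equals
  the flux of the pressure equation: the jumps and the gradient vanish. This is the consistency of
  the two fluxes, in the form in which it passes from \<open>c\<close> to \<open>1 - c\<close>.\<close>
lemma total_flux_complement:
  assumes c: "c \<in> W_h Nx Ny" and e: "e \<in> interior_edges Nx Ny"
  shows "total_flux Nx Ny D \<alpha> \<alpha>t u (\<lambda>i j x y. 1 - c i j x y) e \<beta>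
    = u_hat Nx Ny u e \<beta> \<bullet> normal e - total_flux Nx Ny D \<alpha> \<alpha>t u c e \<beta>"
proof -
  have "(\<lambda>i j x y. 1 - c i j x y) \<in> W_h Nx Ny"
    using W_h_diff[OF W_h_const c, of "\<lambda>_ _. 1" 1] by simp
  then have "grad (\<lambda>i j x y. 1 - c i j x y) i j x y = - grad c i j x y"
    if "i \<in> {1..Nx}" "j \<in> {1..Ny}" for i j x y
    using that c by (simp add: vec_eq_iff forall_2 W_h_grad diff_divide_distrib)
  then have d: "disp_grad D u (\<lambda>i j x y. 1 - c i j x y) i j x y = - disp_grad D u c i j x y"
    if "i \<in> {1..Nx}" "j \<in> {1..Ny}" for i j x y
    using that by (simp add: disp_grad_def matrix_vector_mult_def vec_eq_iff sum_negf)
  show ?thesis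
    using e by (cases e) (simp_all add: interior_edges_Vert interior_edges_Horz total_flux_def
        uc_hat_def u_hat_def mean_def jump_def branch_def d
        algebra_simps add_divide_distrib diff_divide_distrib del: normal.simps)
qed

text \<open>Subtracting the concentration balance from the pressure balance shows that the second component
  \<open>w = \<Phi> - r\<close>, with concentration \<open>v = 1 - c\<close>, obeys a balance of the same form as the first
  component, with \<open>z2\<close> in place of \<open>z1\<close> and \<open>1 - ct\<close> in place of \<open>ct\<close>.\<close>
lemma complement_balance:
  assumes "Nx \<ge> 1" "Ny \<ge> 1" and dt: "\<Delta>t > 0"
    and scheme: "euler_step Nx Ny \<phi> z1 z2 \<mu> \<kappa> q ct D \<alpha> \<alpha>t \<Delta>t p u r pt r'"
    and ij: "i \<in> {2..Nx - 1}" "j \<in> {2..Ny - 1}"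
  defines "w \<equiv> \<lambda>i j x y. Phi Nx Ny \<phi> i j x y - r i j x y"
    and "v \<equiv> \<lambda>i j x y. 1 - conc Nx Ny \<phi> r i j x y"
  shows "cell_avg Nx Ny (Phi Nx Ny \<phi>) i j - cell_avg Nx Ny r' i j
    = cell_quad Nx Ny i j
        (\<lambda>x y. w i j x y + \<Delta>t * ((1 - ct x y) * q x y - z2 * w i j x y * pt i j x y))
      + \<Delta>t / (mesh_size Nx * mesh_size Ny) * net_inflow Nx Ny (total_flux Nx Ny D \<alpha> \<alpha>t u v) i j"
proof -
  let ?H = "mesh_size Nx * mesh_size Ny" and ?P = "Phi Nx Ny \<phi>"
  have H: "?H > 0" using assms(1,2) by (simp add: mesh_size_pos)
  have ij': "i \<in> {1..Nx}" "j \<in> {1..Ny}" using ij by auto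
  have P: "?P \<in> W_h Nx Ny" unfolding Phi_def by (rule interp_in_W_h)
  have C: "conc Nx Ny \<phi> r \<in> W_h Nx Ny" unfolding conc_def by (rule interp_in_W_h)
  note s = scheme[unfolded euler_step_def]
  have W: "r \<in> W_h Nx Ny" "r' \<in> W_h Nx Ny" "pt \<in> W_h Nx Ny" using s by auto
  have peq: "pressure_eq Nx Ny \<phi> z1 z2 q r u pt"
    and ceq: "concentration_eq Nx Ny z1 q ct D \<alpha> \<alpha>t r (conc Nx Ny \<phi> r) u pt
      (\<lambda>i j x y. (r' i j x y - r i j x y) / \<Delta>t)"
    using s by simp_all
  have rt: "(\<lambda>i j x y. (r' i j x y - r i j x y) / \<Delta>t) \<in> W_h Nx Ny"
    using W_h_diff[OF W_h_const W_h_diff[OF W(1,2), of 1], of "\<lambda>_ _. 0" "1 / \<Delta>t"]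
    by (simp add: diff_divide_distrib)
  have dtil: "(\<lambda>i j x y. z1 * r i j x y + z2 * (?P i j x y - r i j x y)) \<in> W_h Nx Ny"
    using W_h_diff[OF W_h_diff[OF W_h_const P, of "\<lambda>_ _. 0" "- z2"] W(1), of "z2 - z1"]
    by (simp add: algebra_simps)
  let ?c = "net_inflow Nx Ny (total_flux Nx Ny D \<alpha> \<alpha>t u (conc Nx Ny \<phi> r)) i j"
  let ?u = "net_inflow Nx Ny (\<lambda>e \<beta>. u_hat Nx Ny u e \<beta> \<bullet> normal e) i j"
  let ?v = "net_inflow Nx Ny (total_flux Nx Ny D \<alpha> \<alpha>t u v) i j"
  have flux: "?v = ?u - ?c"
  proof -
    have e: "Vert (i - 1) j \<in> interior_edges Nx Ny" "Vert i j \<in> interior_edges Nx Ny"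
      "Horz i (j - 1) \<in> interior_edges Nx Ny" "Horz i j \<in> interior_edges Nx Ny"
      using ij by (auto simp: interior_edges_Vert interior_edges_Horz)
    show ?thesis
      unfolding v_def net_inflow_def edge_quad_def e[THEN total_flux_complement[OF C]]
      by (simp add: sum_subtractf right_diff_distrib del: normal.simps)
  qed
  have p: "?H * cell_quad Nx Ny i j (\<lambda>x y. (z1 * r i j x y + z2 * w i j x y) * pt i j x y)
      = ?u + ?H * cell_quad Nx Ny i j q"
    using pressure_balance[OF peq ij] W_h_product_gauss_exact[OF dtil W(3) ij'] by (simp add: w_def)
  have c: "?H * cell_quad Nx Ny i j (\<lambda>x y. (r' i j x y - r i j x y) / \<Delta>t)
      = ?c + ?H * cell_quad Nx Ny i j (\<lambda>x y. ct x y * q x y - r i j x y * z1 * pt i j x y)"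
    using concentration_balance[OF ceq ij] W_h_gauss_exact[OF rt ij'] by simp
  have avg: "cell_avg Nx Ny f i j = cell_quad Nx Ny i j (f i j)" if "f \<in> W_h Nx Ny" for f
    using W_h_gauss_exact[OF that ij'] H by (auto simp: cell_avg_def)
  have lin: "\<Delta>t * cell_quad Nx Ny i j (\<lambda>x y. (r' i j x y - r i j x y) / \<Delta>t)
     = cell_quad Nx Ny i j (r' i j) - cell_quad Nx Ny i j (r i j)"
    using dt by (simp add: cell_quad_def field_simps)
  have Q: "cell_quad Nx Ny i j
        (\<lambda>x y. w i j x y + \<Delta>t * ((1 - ct x y) * q x y - z2 * w i j x y * pt i j x y))
    = cell_quad Nx Ny i j (?P i j) - cell_quad Nx Ny i j (r i j)
      + \<Delta>t * (cell_quad Nx Ny i j q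
      - cell_quad Nx Ny i j (\<lambda>x y. ct x y * q x y - r i j x y * z1 * pt i j x y)
      - cell_quad Nx Ny i j (\<lambda>x y. (z1 * r i j x y + z2 * w i j x y) * pt i j x y))"
    by (simp add: cell_quad_def w_def algebra_simps add_divide_distrib diff_divide_distrib)
  let ?A = "cell_quad Nx Ny i j q"
    and ?B = "cell_quad Nx Ny i j (\<lambda>x y. ct x y * q x y - r i j x y * z1 * pt i j x y)"
    and ?E = "cell_quad Nx Ny i j (\<lambda>x y. (z1 * r i j x y + z2 * w i j x y) * pt i j x y)"
    and ?R = "cell_quad Nx Ny i j (\<lambda>x y. (r' i j x y - r i j x y) / \<Delta>t)"
  have "?v = ?H * (?E - ?A - ?R + ?B)" unfolding flux using p c by (simp add: algebra_simps)
  then have "\<Delta>t / ?H * ?v = \<Delta>t * (?E - ?A - ?R + ?B)" using H by auto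
  then show ?thesis unfolding avg[OF P] avg[OF W(2)] Q using lin by (simp add: algebra_simps)
qed

section \<open>Outflow through one edge\<close>

text \<open>The outflow through an edge, summed over its two Gauss points, stated without reference to the
  orientation of the edge or to the side on which the cell lies: \<open>a\<close>, \<open>b\<close> are the inside traces on the
  edge and on the opposite edge, \<open>o\<close>, \<open>f\<close> those of the neighbouring cell, \<open>hl\<close> is the edge length,
  \<open>hn\<close> the cell width across it, and \<open>ti\<close>, \<open>to\<close> are the tangential derivatives. The outside values enter
  with a favourable sign in the convection and penalty terms, and with an unfavourable one only in the
  dispersion terms, of size at most \<open>d / (2 hn) + sqrt 3 e / hl\<close>; the lower bound on \<open>\<alpha>t\<close> is exactly
  what lets the penalty absorb them. The tangential derivative is bounded through Gauss values
  on the outside, where it has to be compared with the penalty at those points, but through corner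
  values on the inside, which avoids the factor \<open>sqrt 3\<close>.\<close>
lemma edge_outflow_bound:
  fixes hl hn d e :: real
  assumes h: "hl > 0" "hn > 0"
    and inside: "a1 \<ge> 0" "a2 \<ge> 0" "b1 \<ge> 0" "b2 \<ge> 0"
    and outside: "o1 \<ge> 0" "o2 \<ge> 0" "f1 \<ge> 0" "f2 \<ge> 0"
    and adv: "n1 \<ge> 0" "n2 \<ge> 0" "m1 \<le> M" "m2 \<le> M"
    and diag: "di1 \<in> {0..d}" "di2 \<in> {0..d}" "do1 \<in> {0..d}" "do2 \<in> {0..d}"
    and off: "\<bar>ei1\<bar> \<le> e" "\<bar>ei2\<bar> \<le> e" "\<bar>eo1\<bar> \<le> e" "\<bar>eo2\<bar> \<le> e"
    and tang: "\<bar>ti\<bar> \<le> (a1 + a2) / hl" "\<bar>to\<bar> \<le> sqrt 3 * (o1 + o2) / hl"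
    and pen: "\<alpha>t \<ge> hl / (2 * hn) * d + sqrt 3 * e"
  shows "(m1 * a1 - n1 * o1 + (do1 * ((o1 - f1) / hn) + eo1 * to + (di1 * ((b1 - a1) / hn) + ei1 * ti)) / 2
        + \<alpha>t / hl * (a1 - o1))
    + (m2 * a2 - n2 * o2 + (do2 * ((o2 - f2) / hn) + eo2 * to + (di2 * ((b2 - a2) / hn) + ei2 * ti)) / 2
        + \<alpha>t / hl * (a2 - o2))
    \<le> (M + (\<alpha>t + e) / hl) * (a1 + a2) + d / (2 * hn) * (b1 + b2)"
proof -
  have prod: "c * t \<le> e * T" if "\<bar>c\<bar> \<le> e" "\<bar>t\<bar> \<le> T" for c t T :: real
    using mult_mono[of "\<bar>c\<bar>" e "\<bar>t\<bar>" T] that abs_ge_zero[of c] abs_ge_self[of "c * t"]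
    unfolding abs_mult by linarith
  have grad: "c * ((x - y) / hn) \<le> d * x / hn" if "c \<in> {0..d}" "x \<ge> 0" "y \<ge> 0" for c x y
  proof -
    have "c * ((x - y) / hn) \<le> c * (x / hn)"
      using that h by (intro mult_left_mono divide_right_mono) auto
    also have "\<dots> \<le> d * (x / hn)" using that h by (intro mult_right_mono) auto
    finally show ?thesis by simp
  qed
  have T: "ei1 * ti \<le> e * ((a1 + a2) / hl)" "ei2 * ti \<le> e * ((a1 + a2) / hl)"
    "eo1 * to \<le> e * (sqrt 3 * (o1 + o2) / hl)" "eo2 * to \<le> e * (sqrt 3 * (o1 + o2) / hl)"
    using prod off tang by blast+
  have G: "di1 * ((b1 - a1) / hn) \<le> d * b1 / hn" "di2 * ((b2 - a2) / hn) \<le> d * b2 / hn"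
    "do1 * ((o1 - f1) / hn) \<le> d * o1 / hn" "do2 * ((o2 - f2) / hn) \<le> d * o2 / hn"
    using grad diag inside outside by blast+
  have A: "m1 * a1 \<le> M * a1" "m2 * a2 \<le> M * a2" "0 \<le> n1 * o1" "0 \<le> n2 * o2"
    using adv inside outside by (auto intro: mult_right_mono)
  have "(hl / (2 * hn) * d + sqrt 3 * e) * ((o1 + o2) / hl) \<le> \<alpha>t * ((o1 + o2) / hl)"
    using pen outside h by (intro mult_right_mono) auto
  then have P: "d * o1 / hn / 2 + d * o2 / hn / 2 + e * (sqrt 3 * (o1 + o2) / hl) \<le> \<alpha>t / hl * o1 + \<alpha>t / hl * o2"
    using h by (simp add: field_simps)
  have R: "(M + (\<alpha>t + e) / hl) * (a1 + a2) + d / (2 * hn) * (b1 + b2)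
    = M * a1 + M * a2 + \<alpha>t / hl * a1 + \<alpha>t / hl * a2 + e * ((a1 + a2) / hl) + d * b1 / hn / 2 + d * b2 / hn / 2"
    by (simp add: algebra_simps add_divide_distrib)
  show ?thesis unfolding R right_diff_distrib[of "\<alpha>t / hl"] using T G A P by argo
qed

lemma inner_edge_points:
  assumes "Nx \<ge> 1" "Ny \<ge> 1" "i \<ge> 1" "j \<ge> 1" "k \<in> {i - 1, i}" "l \<in> {j - 1, j}"
  shows "(node Nx k, gauss Ny j \<beta>) \<in> cell Nx Ny i j" "(gauss Nx i \<beta>, node Ny l) \<in> cell Nx Ny i j"
    "(node Nx k, node Ny l) \<in> cell Nx Ny i j"
  using assms gauss_between[of Ny j \<beta>] gauss_between[of Nx i \<beta>] node_pred[of i Nx] node_pred[of j Ny]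
    mesh_size_pos[of Nx] mesh_size_pos[of Ny]
  by (auto simp: cell_def)

text \<open>Both sides of a vertical edge: for the cell on its left the outflow is the flux itself and its own
  trace carries the coefficient \<open>\<alpha>\<close>; for the cell on its right the outflow is the negative flux and
  its trace carries \<open>\<alpha> - u\<^sub>1\<^sup>+\<close>. The sum \<open>c i a\<close> is taken over the two corners at \<open>x\<close>-node \<open>a\<close>
  of the cell with index \<open>(i, l)\<close>.\<close>
lemma Vert_outflow_bound:
  assumes v: "v \<in> W_h Nx Ny"
    and nonneg: "\<And>i j x y. i \<in> {1..Nx} \<Longrightarrow> j \<in> {1..Ny} \<Longrightarrow> (x, y) \<in> cell Nx Ny i j \<Longrightarrow> 0 \<le> v i j x y"
    and diag: "\<And>i j x y. i \<in> {1..Nx} \<Longrightarrow> j \<in> {1..Ny} \<Longrightarrow> (x, y) \<in> cell Nx Ny i j \<Longrightarrow>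
      D x y (u i j x y) $ 1 $ 1 \<in> {0..d}"
    and off: "\<And>i j x y. i \<in> {1..Nx} \<Longrightarrow> j \<in> {1..Ny} \<Longrightarrow> (x, y) \<in> cell Nx Ny i j \<Longrightarrow>
      \<bar>D x y (u i j x y) $ 1 $ 2\<bar> \<le> e"
    and pen: "\<alpha>t \<ge> mesh_size Ny / (2 * mesh_size Nx) * d + sqrt 3 * e"
    and kl: "k \<in> {1..<Nx}" "l \<in> {1..Ny}"
    and \<alpha>: "\<alpha> \<ge> 0" "\<And>\<beta>. \<beta> \<in> {1,2} \<Longrightarrow> trace_plus Nx Ny u (Vert k l) \<beta> $ 1 \<le> \<alpha>"
  defines "c \<equiv> \<lambda>i a. v i l (node Nx a) (node Ny (l - 1)) + v i l (node Nx a) (node Ny l)"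
  shows "edge_quad Nx Ny (Vert k l) (total_flux Nx Ny D \<alpha> \<alpha>t u v)
      \<le> mesh_size Ny / 2 * ((\<alpha> + (\<alpha>t + e) / mesh_size Ny) * c k k + d / (2 * mesh_size Nx) * c k (k - 1))"
    and "(\<And>\<beta>. \<beta> \<in> {1,2} \<Longrightarrow> \<alpha> - trace_plus Nx Ny u (Vert k l) \<beta> $ 1 \<le> M) \<Longrightarrow>
      - edge_quad Nx Ny (Vert k l) (total_flux Nx Ny D \<alpha> \<alpha>t u v)
      \<le> mesh_size Ny / 2 * ((M + (\<alpha>t + e) / mesh_size Ny) * c (k + 1) k
          + d / (2 * mesh_size Nx) * c (k + 1) (k + 1))"
proof -
  define hx hy where "hx = mesh_size Nx" and "hy = mesh_size Ny"
  define A where "A \<beta> = v k l (node Nx k) (gauss Ny l \<beta>)" for \<beta>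
  define B where "B \<beta> = v k l (node Nx (k - 1)) (gauss Ny l \<beta>)" for \<beta>
  define C where "C \<beta> = v (k + 1) l (node Nx k) (gauss Ny l \<beta>)" for \<beta>
  define E where "E \<beta> = v (k + 1) l (node Nx (k + 1)) (gauss Ny l \<beta>)" for \<beta>
  define dA where "dA \<beta> = D (node Nx k) (gauss Ny l \<beta>) (u k l (node Nx k) (gauss Ny l \<beta>))" for \<beta>
  define dC where "dC \<beta> = D (node Nx k) (gauss Ny l \<beta>) (u (k + 1) l (node Nx k) (gauss Ny l \<beta>))" for \<beta>
  define tA where "tA = (v k l (node Nx k) (node Ny l) - v k l (node Nx k) (node Ny (l - 1))) / hy"
  define tC where "tC = (v (k + 1) l (node Nx k) (node Ny l) - v (k + 1) l (node Nx k) (node Ny (l - 1))) / hy"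
  define U where "U \<beta> = trace_plus Nx Ny u (Vert k l) \<beta> $ 1" for \<beta>
  have N: "Nx \<ge> 1" "Ny \<ge> 1" using kl by auto
  have h: "hx > 0" "hy > 0" using mesh_size_pos N by (auto simp: hx_def hy_def)
  have kA: "k \<in> {1..Nx}" "l \<in> {1..Ny}" and kC: "k + 1 \<in> {1..Nx}" using kl by auto
  have k1: "k \<ge> 1" "k + 1 \<ge> 1" "l \<ge> 1" using kl by auto
  have ptA: "(node Nx k, gauss Ny l \<beta>) \<in> cell Nx Ny k l" "(node Nx (k - 1), gauss Ny l \<beta>) \<in> cell Nx Ny k l"
    "(node Nx k, node Ny l) \<in> cell Nx Ny k l" "(node Nx k, node Ny (l - 1)) \<in> cell Nx Ny k l" for \<beta>
    using inner_edge_points[OF N k1(1,3)] by auto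
  have ptC: "(node Nx k, gauss Ny l \<beta>) \<in> cell Nx Ny (k + 1) l"
    "(node Nx (k + 1), gauss Ny l \<beta>) \<in> cell Nx Ny (k + 1) l"
    "(node Nx k, node Ny l) \<in> cell Nx Ny (k + 1) l" "(node Nx k, node Ny (l - 1)) \<in> cell Nx Ny (k + 1) l" for \<beta>
    using inner_edge_points[OF N k1(2,3)] by auto
  have flux: "total_flux Nx Ny D \<alpha> \<alpha>t u v (Vert k l) \<beta> = U \<beta> * C \<beta> - \<alpha> * (C \<beta> - A \<beta>)
    - (dC \<beta> $ 1 $ 1 * ((E \<beta> - C \<beta>) / hx) + dC \<beta> $ 1 $ 2 * tC
       + (dA \<beta> $ 1 $ 1 * ((A \<beta> - B \<beta>) / hx) + dA \<beta> $ 1 $ 2 * tA)) / 2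
    - \<alpha>t / hy * (C \<beta> - A \<beta>)" for \<beta>
    using kA kC
    by (simp add: total_flux_def uc_hat_def mean_def jump_def branch_def disp_grad_def
        matrix_vector_mult_def sum_2 W_h_grad[OF v] U_def A_def B_def C_def E_def dA_def dC_def
        tA_def tC_def hx_def hy_def del: normal.simps)
  have nn: "A \<beta> \<ge> 0" "B \<beta> \<ge> 0" "C \<beta> \<ge> 0" "E \<beta> \<ge> 0" for \<beta>
    using nonneg[OF kA ptA(1)] nonneg[OF kA ptA(2)] nonneg[OF kC kA(2) ptC(1)] nonneg[OF kC kA(2) ptC(2)]
    by (auto simp: A_def B_def C_def E_def)
  have dd: "dA \<beta> $ 1 $ 1 \<in> {0..d}" "dC \<beta> $ 1 $ 1 \<in> {0..d}" for \<beta>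
    using diag[OF kA ptA(1)] diag[OF kC kA(2) ptC(1)] unfolding dA_def dC_def by blast+
  have de: "\<bar>dA \<beta> $ 1 $ 2\<bar> \<le> e" "\<bar>dC \<beta> $ 1 $ 2\<bar> \<le> e" for \<beta>
    using off[OF kA ptA(1)] off[OF kC kA(2) ptC(1)] unfolding dA_def dC_def by blast+
  have cs: "c k k = A 1 + A 2" "c k (k - 1) = B 1 + B 2" "c (k + 1) k = C 1 + C 2"
    "c (k + 1) (k + 1) = E 1 + E 2"
    using W_h_gauss_sum_y[OF v kA] W_h_gauss_sum_y[OF v kC kA(2)]
    by (simp_all add: c_def A_def B_def C_def E_def)
  have t_corner: "\<bar>tA\<bar> \<le> (A 1 + A 2) / hy" "\<bar>tC\<bar> \<le> (C 1 + C 2) / hy"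
    using nonneg[OF kA ptA(3)] nonneg[OF kA ptA(4)] nonneg[OF kC kA(2) ptC(3)] nonneg[OF kC kA(2) ptC(4)] h
    unfolding cs[symmetric] c_def tA_def tC_def abs_divide by (auto intro!: divide_right_mono)
  have "tA = sqrt 3 * (A 2 - A 1) / hy" "tC = sqrt 3 * (C 2 - C 1) / hy"
    unfolding tA_def tC_def A_def C_def W_h_gauss_diff_y[OF v kA] W_h_gauss_diff_y[OF v kC kA(2)] by simp_all
  then have t_gauss: "\<bar>tA\<bar> \<le> sqrt 3 * (A 1 + A 2) / hy" "\<bar>tC\<bar> \<le> sqrt 3 * (C 1 + C 2) / hy"
    using nn[of 1] nn[of 2] h by (auto simp: abs_mult intro!: divide_right_mono)
  have U: "U 1 \<le> \<alpha>" "U 2 \<le> \<alpha>" using \<alpha>(2) by (auto simp: U_def)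
  have pen': "\<alpha>t \<ge> hy / (2 * hx) * d + sqrt 3 * e" using pen by (simp add: hx_def hy_def)
  have quad: "edge_quad Nx Ny (Vert k l) (total_flux Nx Ny D \<alpha> \<alpha>t u v)
    = hy / 2 * (total_flux Nx Ny D \<alpha> \<alpha>t u v (Vert k l) 1 + total_flux Nx Ny D \<alpha> \<alpha>t u v (Vert k l) 2)"
    by (simp add: edge_quad_def hy_def)
  have "total_flux Nx Ny D \<alpha> \<alpha>t u v (Vert k l) 1 + total_flux Nx Ny D \<alpha> \<alpha>t u v (Vert k l) 2
    \<le> (\<alpha> + (\<alpha>t + e) / hy) * (A 1 + A 2) + d / (2 * hx) * (B 1 + B 2)"
    using edge_outflow_bound[OF h(2,1) nn(1)[of 1] nn(1)[of 2] nn(2)[of 1] nn(2)[of 2]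
        nn(3)[of 1] nn(3)[of 2] nn(4)[of 1] nn(4)[of 2], of "\<alpha> - U 1" "\<alpha> - U 2" \<alpha> \<alpha> \<alpha>
        "dA 1 $ 1 $ 1" d "dA 2 $ 1 $ 1" "dC 1 $ 1 $ 1" "dC 2 $ 1 $ 1"
        "- dA 1 $ 1 $ 2" e "- dA 2 $ 1 $ 2" "- dC 1 $ 1 $ 2" "- dC 2 $ 1 $ 2" tA tC \<alpha>t]
      U dd de t_corner t_gauss pen'
    unfolding flux by (simp add: algebra_simps add_divide_distrib diff_divide_distrib)
  then show "edge_quad Nx Ny (Vert k l) (total_flux Nx Ny D \<alpha> \<alpha>t u v)
      \<le> mesh_size Ny / 2 * ((\<alpha> + (\<alpha>t + e) / mesh_size Ny) * c k k + d / (2 * mesh_size Nx) * c k (k - 1))"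
    unfolding quad cs hx_def[symmetric] hy_def[symmetric] using h by (intro mult_left_mono) auto
  show "- edge_quad Nx Ny (Vert k l) (total_flux Nx Ny D \<alpha> \<alpha>t u v)
      \<le> mesh_size Ny / 2 * ((M + (\<alpha>t + e) / mesh_size Ny) * c (k + 1) k
          + d / (2 * mesh_size Nx) * c (k + 1) (k + 1))"
    if "\<And>\<beta>. \<beta> \<in> {1,2} \<Longrightarrow> \<alpha> - trace_plus Nx Ny u (Vert k l) \<beta> $ 1 \<le> M"
  proof -
    have M: "\<alpha> - U 1 \<le> M" "\<alpha> - U 2 \<le> M" using that by (auto simp: U_def)
    have "- total_flux Nx Ny D \<alpha> \<alpha>t u v (Vert k l) 1 - total_flux Nx Ny D \<alpha> \<alpha>t u v (Vert k l) 2
      \<le> (M + (\<alpha>t + e) / hy) * (C 1 + C 2) + d / (2 * hx) * (E 1 + E 2)"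
      using edge_outflow_bound[OF h(2,1) nn(3)[of 1] nn(3)[of 2] nn(4)[of 1] nn(4)[of 2]
          nn(1)[of 1] nn(1)[of 2] nn(2)[of 1] nn(2)[of 2], of \<alpha> \<alpha> "\<alpha> - U 1" M "\<alpha> - U 2"
          "dC 1 $ 1 $ 1" d "dC 2 $ 1 $ 1" "dA 1 $ 1 $ 1" "dA 2 $ 1 $ 1"
          "dC 1 $ 1 $ 2" e "dC 2 $ 1 $ 2" "dA 1 $ 1 $ 2" "dA 2 $ 1 $ 2" tC tA \<alpha>t]
        M \<alpha>(1) dd de t_corner t_gauss pen'
      unfolding flux by (simp add: algebra_simps add_divide_distrib diff_divide_distrib)
    then have "hy / 2 * (- total_flux Nx Ny D \<alpha> \<alpha>t u v (Vert k l) 1 - total_flux Nx Ny D \<alpha> \<alpha>t u v (Vert k l) 2)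
      \<le> hy / 2 * ((M + (\<alpha>t + e) / hy) * (C 1 + C 2) + d / (2 * hx) * (E 1 + E 2))"
      using h by (intro mult_left_mono) auto
    then show ?thesis
      unfolding quad cs hx_def[symmetric] hy_def[symmetric] by (simp add: algebra_simps)
  qed
qed

text \<open>Horizontal edges become vertical ones when the two coordinates are exchanged, which also permutes
  the components of the velocity and of the dispersion tensor.\<close>
definition swap_vec :: "'a^2 \<Rightarrow> 'a^2" where
  "swap_vec w = (\<chi> k. if k = 1 then w $ 2 else w $ 1)"

definition swap_mat :: "'a^2^2 \<Rightarrow> 'a^2^2" where
  "swap_mat M = swap_vec (\<chi> k. swap_vec (M $ k))"

lemma swap_vec_simps [simp]: "swap_vec w $ 1 = w $ 2" "swap_vec w $ 2 = w $ 1"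
  "swap_vec (swap_vec w) = w"
  by (simp_all add: swap_vec_def vec_eq_iff forall_2)

lemma swap_mat_simps [simp]: "swap_mat M $ 1 $ 1 = M $ 2 $ 2" "swap_mat M $ 1 $ 2 = M $ 2 $ 1"
  "swap_mat M $ 2 $ 1 = M $ 1 $ 2" "swap_mat M $ 2 $ 2 = M $ 1 $ 1"
  by (simp_all add: swap_mat_def)

lemma W_h_transpose:
  assumes "v \<in> W_h Nx Ny"
  shows "(\<lambda>i j x y. v j i y x) \<in> W_h Ny Nx"
proof (rule W_h_cellI)
  fix i j assume "i \<in> {1..Ny}" "j \<in> {1..Nx}"
  then obtain a b c d where v: "v j i = (\<lambda>x y. a + b * x + c * y + d * x * y)"
    using W_h_cellE[OF assms] by metis
  show "\<exists>a b c d. (\<lambda>x y. v j i y x) = (\<lambda>x y. a + b * x + c * y + d * x * y)"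
    unfolding v by (intro exI[of _ a] exI[of _ c] exI[of _ b] exI[of _ d]) (simp add: algebra_simps)
qed

lemma total_flux_transpose:
  "total_flux Nx Ny D \<alpha> \<alpha>t u v (Horz k l) \<beta>
   = total_flux Ny Nx (\<lambda>x y w. swap_mat (D y x (swap_vec w))) \<alpha> \<alpha>t
       (\<lambda>i j x y. swap_vec (u j i y x)) (\<lambda>i j x y. v j i y x) (Vert l k) \<beta>"
  by (simp add: total_flux_def uc_hat_def mean_def jump_def branch_def disp_grad_def
      matrix_vector_mult_def sum_2 grad_def conj_commute add.commute del: normal.simps)

lemma Horz_outflow_bound:
  assumes v: "v \<in> W_h Nx Ny"
    and nonneg: "\<And>i j x y. i \<in> {1..Nx} \<Longrightarrow> j \<in> {1..Ny} \<Longrightarrow> (x, y) \<in> cell Nx Ny i j \<Longrightarrow> 0 \<le> v i j x y"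
    and diag: "\<And>i j x y. i \<in> {1..Nx} \<Longrightarrow> j \<in> {1..Ny} \<Longrightarrow> (x, y) \<in> cell Nx Ny i j \<Longrightarrow>
      D x y (u i j x y) $ 2 $ 2 \<in> {0..d}"
    and off: "\<And>i j x y. i \<in> {1..Nx} \<Longrightarrow> j \<in> {1..Ny} \<Longrightarrow> (x, y) \<in> cell Nx Ny i j \<Longrightarrow>
      \<bar>D x y (u i j x y) $ 2 $ 1\<bar> \<le> e"
    and pen: "\<alpha>t \<ge> mesh_size Nx / (2 * mesh_size Ny) * d + sqrt 3 * e"
    and kl: "k \<in> {1..Nx}" "l \<in> {1..<Ny}"
    and \<alpha>: "\<alpha> \<ge> 0" "\<And>\<beta>. \<beta> \<in> {1,2} \<Longrightarrow> trace_plus Nx Ny u (Horz k l) \<beta> $ 2 \<le> \<alpha>"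
  defines "c \<equiv> \<lambda>j b. v k j (node Nx (k - 1)) (node Ny b) + v k j (node Nx k) (node Ny b)"
  shows "edge_quad Nx Ny (Horz k l) (total_flux Nx Ny D \<alpha> \<alpha>t u v)
      \<le> mesh_size Nx / 2 * ((\<alpha> + (\<alpha>t + e) / mesh_size Nx) * c l l + d / (2 * mesh_size Ny) * c l (l - 1))"
    and "(\<And>\<beta>. \<beta> \<in> {1,2} \<Longrightarrow> \<alpha> - trace_plus Nx Ny u (Horz k l) \<beta> $ 2 \<le> M) \<Longrightarrow>
      - edge_quad Nx Ny (Horz k l) (total_flux Nx Ny D \<alpha> \<alpha>t u v)
      \<le> mesh_size Nx / 2 * ((M + (\<alpha>t + e) / mesh_size Nx) * c (l + 1) l
          + d / (2 * mesh_size Ny) * c (l + 1) (l + 1))"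
proof -
  let ?D = "\<lambda>x y w. swap_mat (D y x (swap_vec w))" and ?u = "\<lambda>i j x y. swap_vec (u j i y x)"
    and ?v = "\<lambda>i j x y. v j i y x"
  have cell: "(y, x) \<in> cell Nx Ny j i" if "(x, y) \<in> cell Ny Nx i j" for x y i j
    using that by (auto simp: cell_def)
  have quad: "edge_quad Nx Ny (Horz k l) (total_flux Nx Ny D \<alpha> \<alpha>t u v)
    = edge_quad Ny Nx (Vert l k) (total_flux Ny Nx ?D \<alpha> \<alpha>t ?u ?v)"
    unfolding edge_quad_def total_flux_transpose by simp
  have tr: "trace_plus Ny Nx ?u (Vert l k) \<beta> $ 1 = trace_plus Nx Ny u (Horz k l) \<beta> $ 2" for \<beta>
    using kl by (simp add: branch_def)
  note * = Vert_outflow_bound[OF W_h_transpose[OF v], of ?D ?u d e \<alpha>t l k \<alpha>]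
  show "edge_quad Nx Ny (Horz k l) (total_flux Nx Ny D \<alpha> \<alpha>t u v)
      \<le> mesh_size Nx / 2 * ((\<alpha> + (\<alpha>t + e) / mesh_size Nx) * c l l + d / (2 * mesh_size Ny) * c l (l - 1))"
    unfolding quad c_def
    by (rule *(1)) (use nonneg diag off pen kl \<alpha> cell in \<open>auto simp: tr simp del: trace_plus.simps\<close>)
  show "- edge_quad Nx Ny (Horz k l) (total_flux Nx Ny D \<alpha> \<alpha>t u v)
      \<le> mesh_size Nx / 2 * ((M + (\<alpha>t + e) / mesh_size Nx) * c (l + 1) l
          + d / (2 * mesh_size Ny) * c (l + 1) (l + 1))"
    if "\<And>\<beta>. \<beta> \<in> {1,2} \<Longrightarrow> \<alpha> - trace_plus Nx Ny u (Horz k l) \<beta> $ 2 \<le> M"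
    unfolding quad c_def
    by (rule *(2)) (use nonneg diag off pen kl \<alpha> cell that in \<open>auto simp: tr simp del: trace_plus.simps\<close>)
qed

section \<open>The budget of a cell\<close>

text \<open>The four outflow bounds are collected corner by corner (\<open>v1\<close> to \<open>v4\<close>: lower left, lower right,
  upper left, upper right). A corner lies on one vertical and one horizontal edge, so its convective
  coefficient is half of \<open>\<tau>x a + \<tau>y b\<close>, with \<open>a\<close>, \<open>b\<close> the coefficients on these edges. Here
  \<open>\<tau>x = \<Delta>t / hx\<close>, \<open>\<tau>y = \<Delta>t / hy\<close>, and \<open>a\<close>, \<open>b\<close> are at most \<open>p / (6 (\<tau>x + \<tau>y))\<close> for the porosity \<open>p\<close> at
  the corner; as \<open>\<tau>x\<close> and \<open>\<tau>y\<close> add up to the denominator, the coefficient is at most \<open>p / 12\<close>. The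
  dispersive and penalty coefficients contribute at most another \<open>p / 24\<close>.\<close>
lemma cell_outflow_budget:
  fixes hx hy \<Delta>t \<alpha> \<alpha>t :: real
  assumes h: "hx > 0" "hy > 0" "\<Delta>t > 0"
    and v: "v1 \<ge> 0" "v2 \<ge> 0" "v3 \<ge> 0" "v4 \<ge> 0"
    and m: "m \<le> p1" "m \<le> p2" "m \<le> p3" "m \<le> p4"
    and adv: "(\<Delta>t / hx + \<Delta>t / hy) * \<alpha> \<le> m / 6"
      "(\<Delta>t / hx + \<Delta>t / hy) * Ml \<le> p1 / 6" "(\<Delta>t / hx + \<Delta>t / hy) * Ml \<le> p3 / 6"
      "(\<Delta>t / hx + \<Delta>t / hy) * Mb \<le> p1 / 6" "(\<Delta>t / hx + \<Delta>t / hy) * Mb \<le> p2 / 6"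
    and diff: "d1 * (\<Delta>t / hx\<^sup>2) + 2 * (\<alpha>t + e1) * (\<Delta>t / (hx * hy)) \<le> m / 12"
      "d2 * (\<Delta>t / hy\<^sup>2) + 2 * (\<alpha>t + e2) * (\<Delta>t / (hx * hy)) \<le> m / 12"
  shows "\<Delta>t / (hx * hy) *
      (hy / 2 * ((Ml + (\<alpha>t + e1) / hy) * (v1 + v3) + d1 / (2 * hx) * (v2 + v4))
      + hy / 2 * ((\<alpha> + (\<alpha>t + e1) / hy) * (v2 + v4) + d1 / (2 * hx) * (v1 + v3))
      + hx / 2 * ((Mb + (\<alpha>t + e2) / hx) * (v1 + v2) + d2 / (2 * hy) * (v3 + v4))
      + hx / 2 * ((\<alpha> + (\<alpha>t + e2) / hx) * (v3 + v4) + d2 / (2 * hy) * (v1 + v2)))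
    \<le> (p1 * v1 + p2 * v2 + p3 * v3 + p4 * v4) / 8"
proof -
  define \<tau>x \<tau>y where "\<tau>x = \<Delta>t / hx" and "\<tau>y = \<Delta>t / hy"
  define K1 K2 where "K1 = d1 * (\<Delta>t / hx\<^sup>2) + 2 * (\<alpha>t + e1) * (\<Delta>t / (hx * hy))"
    and "K2 = d2 * (\<Delta>t / hy\<^sup>2) + 2 * (\<alpha>t + e2) * (\<Delta>t / (hx * hy))"
  have t: "\<tau>x > 0" "\<tau>y > 0" using h by (auto simp: \<tau>x_def \<tau>y_def)
  have convex: "\<tau>x * a + \<tau>y * b \<le> q" if "(\<tau>x + \<tau>y) * a \<le> q" "(\<tau>x + \<tau>y) * b \<le> q" for a b q
  proof -
    have "a \<le> q / (\<tau>x + \<tau>y)" "b \<le> q / (\<tau>x + \<tau>y)"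
      using that t by (simp_all add: pos_le_divide_eq mult.commute)
    then have "\<tau>x * a + \<tau>y * b \<le> \<tau>x * (q / (\<tau>x + \<tau>y)) + \<tau>y * (q / (\<tau>x + \<tau>y))"
      using t by (intro add_mono mult_left_mono) auto
    also have "\<dots> = (\<tau>x + \<tau>y) * (q / (\<tau>x + \<tau>y))" by (simp only: distrib_right)
    also have "\<dots> = q" using t by simp
    finally show ?thesis .
  qed
  note adv' = adv[folded \<tau>x_def \<tau>y_def] and diff' = diff[folded K1_def K2_def]
  have corner: "((\<tau>x * a + \<tau>y * b) / 2 + (K1 + K2) / 4) * z \<le> p * z / 8"
    if "(\<tau>x + \<tau>y) * a \<le> p / 6" "(\<tau>x + \<tau>y) * b \<le> p / 6" "m \<le> p" "z \<ge> 0" for a b p z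
  proof -
    have "(\<tau>x * a + \<tau>y * b) / 2 + (K1 + K2) / 4 \<le> p / 8"
    proof -
      have "(K1 + K2) / 4 \<le> p / 24" using diff' that(3) by argo
      moreover have "(\<tau>x * a + \<tau>y * b) / 2 \<le> p / 12"
        using divide_right_mono[OF convex[OF that(1,2)], of 2] by simp
      ultimately show ?thesis by linarith
    qed
    from mult_right_mono[OF this that(4)] show ?thesis by simp
  qed
  have L: "\<Delta>t / (hx * hy) *
      (hy / 2 * ((Ml + (\<alpha>t + e1) / hy) * (v1 + v3) + d1 / (2 * hx) * (v2 + v4))
      + hy / 2 * ((\<alpha> + (\<alpha>t + e1) / hy) * (v2 + v4) + d1 / (2 * hx) * (v1 + v3))
      + hx / 2 * ((Mb + (\<alpha>t + e2) / hx) * (v1 + v2) + d2 / (2 * hy) * (v3 + v4))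
      + hx / 2 * ((\<alpha> + (\<alpha>t + e2) / hx) * (v3 + v4) + d2 / (2 * hy) * (v1 + v2)))
    = ((\<tau>x * Ml + \<tau>y * Mb) / 2 + (K1 + K2) / 4) * v1
      + ((\<tau>x * \<alpha> + \<tau>y * Mb) / 2 + (K1 + K2) / 4) * v2
      + ((\<tau>x * Ml + \<tau>y * \<alpha>) / 2 + (K1 + K2) / 4) * v3
      + ((\<tau>x * \<alpha> + \<tau>y * \<alpha>) / 2 + (K1 + K2) / 4) * v4"
    using h by (simp add: \<tau>x_def \<tau>y_def K1_def K2_def field_simps power2_eq_square)
  have adv_\<alpha>: "(\<tau>x + \<tau>y) * \<alpha> \<le> p2 / 6" "(\<tau>x + \<tau>y) * \<alpha> \<le> p3 / 6" "(\<tau>x + \<tau>y) * \<alpha> \<le> p4 / 6"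
    using adv'(1) m by argo+
  show ?thesis unfolding L add_divide_distrib[of _ _ 8]
    using adv' adv_\<alpha> m v by (intro add_mono corner)
qed

section \<open>Consequences of the time step and penalty conditions\<close>
lemma max_Omega_upper:
  assumes "i \<in> {1..Nx}" "j \<in> {1..Ny}" "(x, y) \<in> cell Nx Ny i j"
  shows "ereal (f i j x y) \<le> max_Omega Nx Ny f"
  unfolding max_Omega_def
  by (rule SUP_upper2[OF assms(1)], rule SUP_upper2[OF assms(2)], rule SUP_upper2[OF assms(3)]) simp

text \<open>The suprema of the dispersion coefficients are extended reals; a finite upper bound on a positive
  combination of them makes them finite.\<close>
lemma ereal_weighted_sum_finite:
  fixes X Y :: ereal
  assumes "ereal k * X + ereal s * Y \<le> ereal t" "k > 0" "s > 0" "0 \<le> X" "0 \<le> Y"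
  obtains a b where "X = ereal a" "Y = ereal b" "k * a + s * b \<le> t"
  using assms by (cases X; cases Y) auto

lemma ereal_le_inverse_imp:
  assumes "ereal t \<le> 1 / ereal b" "b \<ge> 0"
  shows "t * b \<le> 1"
proof (cases "b = 0")
  case False
  then have "b > 0" using assms(2) by simp
  moreover have "t \<le> 1 / b" using assms(1) False by (simp add: one_ereal_def)
  ultimately show ?thesis by (simp add: field_simps)
qed simp

lemma ereal_le_divide_imp:
  assumes "ereal t \<le> ereal a / ereal b" "b > 0"
  shows "t * b \<le> a"
proof -
  have "t \<le> a / b" using assms by simp
  then show ?thesis using assms(2) by (simp add: field_simps)
qed

lemma cell_subset_square:
  assumes "Nx \<ge> 1" "Ny \<ge> 1" "i \<in> {1..Nx}" "j \<in> {1..Ny}" "(x, y) \<in> cell Nx Ny i j"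
  shows "x \<in> {0..2*pi}" "y \<in> {0..2*pi}"
proof -
  have "i - 1 \<le> Nx" "j - 1 \<le> Ny" "i \<le> Nx" "j \<le> Ny" using assms(3,4) by auto
  then have "node Nx (i - 1) \<ge> 0" "node Nx i \<le> 2 * pi" "node Ny (j - 1) \<ge> 0" "node Ny j \<le> 2 * pi"
    using node_bounds[OF assms(1)] node_bounds[OF assms(2)] by (metis atLeastAtMost_iff)+
  then show "x \<in> {0..2*pi}" "y \<in> {0..2*pi}"
    using assms(5) unfolding cell_def by auto
qed

lemma Phi_node_pos:
  assumes "Nx \<ge> 1" "Ny \<ge> 1" "\<forall>x\<in>{0..2*pi}. \<forall>y\<in>{0..2*pi}. \<phi> x y > 0" "k \<le> Nx" "l \<le> Ny"
  shows "Phi_node Nx Ny \<phi> k l > 0"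
  using assms node_bounds unfolding Phi_node_def by blast

text \<open>\<open>c\<close> and \<open>\<Phi>\<close> are interpolants, so the identity \<open>\<Phi> - r = \<phi> (1 - c)\<close> holds at the corners,
  although in general not inside the cell.\<close>
lemma complement_at_corner:
  fixes \<phi> :: "real \<Rightarrow> real \<Rightarrow> real"
  assumes N: "Nx \<ge> 1" "Ny \<ge> 1" and pos: "\<forall>x\<in>{0..2*pi}. \<forall>y\<in>{0..2*pi}. \<phi> x y > 0"
    and ij: "i \<in> {1..Nx}" "j \<in> {1..Ny}" and kl: "k \<in> {i - 1, i}" "l \<in> {j - 1, j}"
    and r: "r i j (node Nx k) (node Ny l) \<le> Phi Nx Ny \<phi> i j (node Nx k) (node Ny l)"
  shows "0 \<le> 1 - conc Nx Ny \<phi> r i j (node Nx k) (node Ny l)"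
    and "Phi Nx Ny \<phi> i j (node Nx k) (node Ny l) - r i j (node Nx k) (node Ny l)
      = Phi_node Nx Ny \<phi> k l * (1 - conc Nx Ny \<phi> r i j (node Nx k) (node Ny l))"
proof -
  have ij1: "i \<ge> 1" "j \<ge> 1" using ij by auto
  have P: "Phi_node Nx Ny \<phi> k l > 0" using Phi_node_pos[OF N pos] ij kl by auto
  have e: "Phi Nx Ny \<phi> i j (node Nx k) (node Ny l) = Phi_node Nx Ny \<phi> k l"
    unfolding Phi_def using interp_at_corner[OF N ij1 kl, of "\<lambda>i j. \<phi>"] by (simp add: Phi_node_def)
  have c: "conc Nx Ny \<phi> r i j (node Nx k) (node Ny l) = r i j (node Nx k) (node Ny l) / Phi_node Nx Ny \<phi> k l"
    unfolding conc_def interp_at_corner[OF N ij1 kl] e ..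
  show "0 \<le> 1 - conc Nx Ny \<phi> r i j (node Nx k) (node Ny l)" using r P unfolding c e by simp
  show "Phi Nx Ny \<phi> i j (node Nx k) (node Ny l) - r i j (node Nx k) (node Ny l)
      = Phi_node Nx Ny \<phi> k l * (1 - conc Nx Ny \<phi> r i j (node Nx k) (node Ny l))"
    using P unfolding c e by (simp add: field_simps)
qed

lemma Phi_min_le: "k \<le> Nx \<Longrightarrow> l \<le> Ny \<Longrightarrow> Phi_min Nx Ny \<phi> \<le> Phi_node Nx Ny \<phi> k l"
  unfolding Phi_min_def by (intro Min_le) force+

lemma Phi_cell_min_le:
  "k \<in> {i - 1, i} \<Longrightarrow> l \<in> {j - 1, j} \<Longrightarrow> Phi_cell_min Nx Ny \<phi> i j \<le> Phi_node Nx Ny \<phi> k l"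
  unfolding Phi_cell_min_def by (intro Min_le) force+

lemma u_max_upper:
  assumes "i \<in> {1..Nx - 1}" "j \<in> {1..Ny - 1}" "\<beta> \<in> {1,2}"
  shows "trace_plus Nx Ny u (Vert i j) \<beta> $ 1 \<le> u_max Nx Ny u"
    "trace_plus Nx Ny u (Horz i j) \<beta> $ 2 \<le> u_max Nx Ny u"
  unfolding u_max_def by (rule Max_ge; use assms in blast)+

lemma p_max_upper:
  assumes "i \<in> {1..Nx}" "j \<in> {1..Ny}" "\<beta> \<in> {1,2}" "\<gamma> \<in> {1,2}"
  shows "pt i j (gauss Nx i \<beta>) (gauss Ny j \<gamma>) \<le> p_max Nx Ny pt" "0 \<le> p_max Nx Ny pt"
  unfolding p_max_def by (rule Max_ge; use assms in blast)+

lemma q_neg_max_upper: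
  assumes "\<beta> \<in> {1,2}" "\<gamma> \<in> {1,2}"
  shows "- q (gauss Nx i \<beta>) (gauss Ny j \<gamma>) \<le> q_neg_max Nx Ny q i j"
  unfolding q_neg_max_def by (rule Max_ge; use assms in blast)

lemma B1_lower:
  assumes "i \<in> {1..Nx - 1}" "j \<in> {1..Ny}" "\<beta> \<in> {1,2}" "l \<in> {j - 1, j}"
  shows "B1 Nx Ny \<phi> \<alpha> u \<le> ereal (Phi_node Nx Ny \<phi> i l) / ereal (\<alpha> - trace_plus Nx Ny u (Vert i j) \<beta> $ 1)"
  unfolding B1_def
  by (rule INF_lower2[OF assms(1)], rule INF_lower2[OF assms(2)], rule INF_lower2[OF assms(3)],
      rule INF_lower2[OF assms(4)]) simp

lemma B2_lower:
  assumes "i \<in> {1..Nx}" "j \<in> {1..Ny - 1}" "\<beta> \<in> {1,2}" "k \<in> {i - 1, i}"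
  shows "B2 Nx Ny \<phi> \<alpha> u \<le> ereal (Phi_node Nx Ny \<phi> k j) / ereal (\<alpha> - trace_plus Nx Ny u (Horz i j) \<beta> $ 2)"
  unfolding B2_def
  by (rule INF_lower2[OF assms(1)], rule INF_lower2[OF assms(2)], rule INF_lower2[OF assms(3)],
      rule INF_lower2[OF assms(4)]) simp

theorem theorem3p4:
  fixes Nx Ny :: nat
    and \<phi> q ct \<kappa> :: "real \<Rightarrow> real \<Rightarrow> real"
    and \<mu> :: "real \<Rightarrow> real"
    and z1 z2 \<alpha> \<alpha>t \<Delta>t \<Delta>x \<Delta>y lam Lam1 Lam2 :: real
    and D :: "real \<Rightarrow> real \<Rightarrow> real^2 \<Rightarrow> real^2^2"
    and p r r' pt :: "real cellwise"
    and u :: "(real^2) cellwise"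
    and D11 D12 D21 D22 :: ereal
  assumes mesh: "Nx \<ge> 1" "Ny \<ge> 1"
    and sizes: "\<Delta>x = mesh_size Nx" "\<Delta>y = mesh_size Ny"
    and ratios: "lam = \<Delta>t / (\<Delta>x * \<Delta>y)" "Lam1 = \<Delta>t / \<Delta>x\<^sup>2" "Lam2 = \<Delta>t / \<Delta>y\<^sup>2"
    and D_max:
      "D11 = max_Omega Nx Ny (\<lambda>i j x y. D x y (u i j x y) $ 1 $ 1)"
      "D22 = max_Omega Nx Ny (\<lambda>i j x y. D x y (u i j x y) $ 2 $ 2)"
      "D12 = max_Omega Nx Ny (\<lambda>i j x y. \<bar>D x y (u i j x y) $ 1 $ 2\<bar>)"
      "D21 = max_Omega Nx Ny (\<lambda>i j x y. \<bar>D x y (u i j x y) $ 2 $ 1\<bar>)"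
    and positive: "z1 > 0" "z2 > 0" "\<alpha> > 0" "\<alpha>t > 0" "\<Delta>t > 0"
    and porosity: "\<forall>x\<in>{0..2*pi}. \<forall>y\<in>{0..2*pi}. \<phi> x y > 0"
    and D_sym: "\<forall>x\<in>{0..2*pi}. \<forall>y\<in>{0..2*pi}. \<forall>v. transpose (D x y v) = D x y v"
    and D_psd: "\<forall>x\<in>{0..2*pi}. \<forall>y\<in>{0..2*pi}. \<forall>v w. 0 \<le> w \<bullet> (D x y v *v w)"
    and ct_range: "\<forall>x\<in>{0..2*pi}. \<forall>y\<in>{0..2*pi}. 0 \<le> ct x y \<and> ct x y \<le> 1"
    and ct_sink: "\<forall>i\<in>{1..Nx}. \<forall>j\<in>{1..Ny}. \<forall>(x, y)\<in>interior (cell Nx Ny i j).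
      q x y < 0 \<longrightarrow> ct x y = conc Nx Ny \<phi> r i j x y"
    and scheme: "euler_step Nx Ny \<phi> z1 z2 \<mu> \<kappa> q ct D \<alpha> \<alpha>t \<Delta>t p u r pt r'"
    and r_bounds: "\<forall>i\<in>{1..Nx}. \<forall>j\<in>{1..Ny}. \<forall>(x, y)\<in>cell Nx Ny i j.
      0 \<le> r i j x y \<and> r i j x y \<le> Phi Nx Ny \<phi> i j x y"
    and r_pos: "\<forall>i\<in>{1..Nx}. \<forall>j\<in>{1..Ny}. \<forall>(x, y)\<in>cell Nx Ny i j. r i j x y > 0"
    and alpha: "\<alpha> > u_max Nx Ny u"
    and alphat:
      "ereal \<alpha>t \<ge> ereal (\<Delta>y / (2 * \<Delta>x)) * D11 + ereal (sqrt 3) * D12"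
      "ereal \<alpha>t \<ge> ereal (\<Delta>x / (2 * \<Delta>y)) * D22 + ereal (sqrt 3) * D21"
    and cfl: "ereal (\<Delta>t / \<Delta>x + \<Delta>t / \<Delta>y)
      \<le> ereal (1/6) * Min {ereal (Phi_min Nx Ny \<phi> / \<alpha>), B1 Nx Ny \<phi> \<alpha> u, B2 Nx Ny \<phi> \<alpha> u}"
    and diffusive_cfl:
      "D11 * ereal Lam1 + 2 * (ereal \<alpha>t + D12) * ereal lam \<le> ereal (1/12 * Phi_min Nx Ny \<phi>)"
      "D22 * ereal Lam2 + 2 * (ereal \<alpha>t + D21) * ereal lam \<le> ereal (1/12 * Phi_min Nx Ny \<phi>)"
    and dt_z1: "ereal \<Delta>t \<le> 1 / ereal (6 * z1 * p_max Nx Ny pt)"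
    and dt_q: "ereal \<Delta>t \<le> (INF i\<in>{1..Nx}. INF j\<in>{1..Ny}.
      ereal (Phi_cell_min Nx Ny \<phi> i j) / ereal (6 * q_neg_max Nx Ny q i j))"
    and consistent: "consistent_fluxes Nx Ny (uc_hat Nx Ny \<alpha>) (u_hat Nx Ny)"
    and dt_z2: "ereal \<Delta>t \<le> 1 / ereal (6 * z2 * p_max Nx Ny pt)"
  shows "\<forall>i\<in>{2..Nx - 1}. \<forall>j\<in>{2..Ny - 1}.
    cell_avg Nx Ny r' i j \<le> cell_avg Nx Ny (Phi Nx Ny \<phi>) i j"
proof (intro ballI)
  fix i j assume ij: "i \<in> {2..Nx - 1}" "j \<in> {2..Ny - 1}"
  define v where "v = (\<lambda>i j x y. 1 - conc Nx Ny \<phi> r i j x y)"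
  define w where "w = (\<lambda>i j x y. Phi Nx Ny \<phi> i j x y - r i j x y)"
  define S where "S = \<Delta>t / \<Delta>x + \<Delta>t / \<Delta>y"
  let ?P = "Phi_node Nx Ny \<phi>"
  have ij': "i \<in> {1..Nx}" "j \<in> {1..Ny}" and ij1: "i \<ge> 1" "j \<ge> 1" using ij by auto
  have h: "\<Delta>x > 0" "\<Delta>y > 0" using mesh_size_pos mesh sizes by auto
  have W: "r \<in> W_h Nx Ny" using scheme by (simp add: euler_step_def)
  have vW: "v \<in> W_h Nx Ny"
    unfolding v_def conc_def using W_h_diff[OF W_h_const interp_in_W_h, of "\<lambda>_ _. 1" 1] by simp
  have wW: "w \<in> W_h Nx Ny"
    unfolding w_def Phi_def using W_h_diff[OF interp_in_W_h W, of _ 1] by simp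

  have corner: "0 \<le> v a b (node Nx k) (node Ny l)"
    "w a b (node Nx k) (node Ny l) = ?P k l * v a b (node Nx k) (node Ny l)"
    if "a \<in> {1..Nx}" "b \<in> {1..Ny}" "k \<in> {a - 1, a}" "l \<in> {b - 1, b}" for a b k l
  proof -
    have "(node Nx k, node Ny l) \<in> cell Nx Ny a b"
      using inner_edge_points(3)[OF mesh, of a b k l] that by auto
    then have "r a b (node Nx k) (node Ny l) \<le> Phi Nx Ny \<phi> a b (node Nx k) (node Ny l)"
      using r_bounds that(1,2) by blast
    from complement_at_corner[OF mesh porosity that, of r, OF this]
    show "0 \<le> v a b (node Nx k) (node Ny l)"
      "w a b (node Nx k) (node Ny l) = ?P k l * v a b (node Nx k) (node Ny l)"
      unfolding v_def w_def by blast+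
  qed
  have v_nonneg: "0 \<le> v a b x y"
    if "a \<in> {1..Nx}" "b \<in> {1..Ny}" "(x, y) \<in> cell Nx Ny a b" for a b x y
    using W_h_nonneg_if_corners[OF vW that(1,2) corner(1)[OF that(1,2)] that(3)] .
  have w_nonneg: "0 \<le> w i j x y" if "(x, y) \<in> cell Nx Ny i j" for x y
    using r_bounds ij' that unfolding w_def by fastforce
  \<comment> \<open>both sides are bilinear, so it suffices to compare them at the corners\<close>
  have w_ge: "Phi_cell_min Nx Ny \<phi> i j * v i j x y \<le> w i j x y" if "(x, y) \<in> cell Nx Ny i j" for x y
  proof -
    have "0 \<le> w i j (node Nx k) (node Ny l) - Phi_cell_min Nx Ny \<phi> i j * v i j (node Nx k) (node Ny l)"
      if "k \<in> {i - 1, i}" "l \<in> {j - 1, j}" for k l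
      using corner[OF ij' that] mult_right_mono[OF Phi_cell_min_le[OF that]] by fastforce
    from W_h_nonneg_if_corners[OF W_h_diff[OF wW vW] ij' this that] show ?thesis by simp
  qed

  \<comment> \<open>the diagonal entries of a positive semidefinite matrix are its values at the unit vectors\<close>
  have D_sq: "D x y (u a b x y) $ 1 $ 1 \<ge> 0" "D x y (u a b x y) $ 2 $ 2 \<ge> 0"
    if "a \<in> {1..Nx}" "b \<in> {1..Ny}" "(x, y) \<in> cell Nx Ny a b" for a b x y
  proof -
    have "0 \<le> axis k 1 \<bullet> (D x y (u a b x y) *v axis k 1)" for k
      using D_psd cell_subset_square[OF mesh that] by blast
    then have "0 \<le> D x y (u a b x y) $ k $ k" for k
      by (simp add: inner_axis' matrix_vector_mult_basis column_def)
    then show "D x y (u a b x y) $ 1 $ 1 \<ge> 0" "D x y (u a b x y) $ 2 $ 2 \<ge> 0" by blast+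
  qed
  have pt_ex: "(gauss Nx i 1, gauss Ny j 1) \<in> cell Nx Ny i j"
    using gauss_in_cell[OF mesh ij1] interior_subset by blast
  have D_nonneg: "0 \<le> D11" "0 \<le> D22" "0 \<le> D12" "0 \<le> D21"
    unfolding D_max using D_sq[OF ij' pt_ex]
    by (intro order_trans[OF _ max_Omega_upper[OF ij' pt_ex]]; simp)+
  obtain d1 e1 where D1: "D11 = ereal d1" "D12 = ereal e1"
    and pen1: "\<Delta>y / (2 * \<Delta>x) * d1 + sqrt 3 * e1 \<le> \<alpha>t"
    using ereal_weighted_sum_finite[OF alphat(1)] h D_nonneg by auto
  obtain d2 e2 where D2: "D22 = ereal d2" "D21 = ereal e2"
    and pen2: "\<Delta>x / (2 * \<Delta>y) * d2 + sqrt 3 * e2 \<le> \<alpha>t"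
    using ereal_weighted_sum_finite[OF alphat(2)] h D_nonneg by auto
  have D_bounds: "D x y (u a b x y) $ 1 $ 1 \<in> {0..d1}" "\<bar>D x y (u a b x y) $ 1 $ 2\<bar> \<le> e1"
    "D x y (u a b x y) $ 2 $ 2 \<in> {0..d2}" "\<bar>D x y (u a b x y) $ 2 $ 1\<bar> \<le> e2"
    if "a \<in> {1..Nx}" "b \<in> {1..Ny}" "(x, y) \<in> cell Nx Ny a b" for a b x y
    using D_sq[OF that] max_Omega_upper[OF that, of "\<lambda>i j x y. D x y (u i j x y) $ 1 $ 1"]
      max_Omega_upper[OF that, of "\<lambda>i j x y. D x y (u i j x y) $ 2 $ 2"]
      max_Omega_upper[OF that, of "\<lambda>i j x y. \<bar>D x y (u i j x y) $ 1 $ 2\<bar>"]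
      max_Omega_upper[OF that, of "\<lambda>i j x y. \<bar>D x y (u i j x y) $ 2 $ 1\<bar>"]
    unfolding D_max[symmetric] D1 D2 by simp_all
  have diffusive: "d1 * (\<Delta>t / \<Delta>x\<^sup>2) + 2 * (\<alpha>t + e1) * (\<Delta>t / (\<Delta>x * \<Delta>y)) \<le> Phi_min Nx Ny \<phi> / 12"
    "d2 * (\<Delta>t / \<Delta>y\<^sup>2) + 2 * (\<alpha>t + e2) * (\<Delta>t / (\<Delta>x * \<Delta>y)) \<le> Phi_min Nx Ny \<phi> / 12"
    using diffusive_cfl unfolding D1 D2 ratios by simp_all

  \<comment> \<open>\<open>B1\<close> and \<open>B2\<close> are infima of extended quotients, so the condition is applied through a member \<open>X\<close>
    of the minimum that lies below a single real quotient\<close>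
  have cfl': "S * b \<le> a / 6"
    if "X \<in> {ereal (Phi_min Nx Ny \<phi> / \<alpha>), B1 Nx Ny \<phi> \<alpha> u, B2 Nx Ny \<phi> \<alpha> u}" "X \<le> ereal a / ereal b" "b > 0"
    for X a b
  proof -
    have "Min {ereal (Phi_min Nx Ny \<phi> / \<alpha>), B1 Nx Ny \<phi> \<alpha> u, B2 Nx Ny \<phi> \<alpha> u} \<le> ereal (a / b)"
      using that by (intro order_trans[OF Min_le[OF _ that(1)]]) auto
    then have "ereal (1/6) * Min {ereal (Phi_min Nx Ny \<phi> / \<alpha>), B1 Nx Ny \<phi> \<alpha> u, B2 Nx Ny \<phi> \<alpha> u}
      \<le> ereal (1/6) * ereal (a / b)"
      by (intro ereal_mult_left_mono) auto
    from order_trans[OF cfl this] have "S \<le> a / b / 6" by (simp add: S_def mult.commute)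
    from mult_right_mono[OF this less_imp_le[OF that(3)]] show ?thesis using that(3) by simp
  qed
  have adv: "S * \<alpha> \<le> Phi_min Nx Ny \<phi> / 6"
    using cfl'[of "ereal (Phi_min Nx Ny \<phi> / \<alpha>)" "Phi_min Nx Ny \<phi>" \<alpha>] positive(3) by simp
  have uV: "trace_plus Nx Ny u (Vert k j) \<beta> $ 1 < \<alpha>" if "k \<in> {i - 1, i}" "\<beta> \<in> {1,2}" for k \<beta>
    using u_max_upper(1)[of k Nx j Ny \<beta> u] that ij alpha by fastforce
  have uH: "trace_plus Nx Ny u (Horz i l) \<beta> $ 2 < \<alpha>" if "l \<in> {j - 1, j}" "\<beta> \<in> {1,2}" for l \<beta>
    using u_max_upper(2)[of i Nx l Ny \<beta> u] that ij alpha by fastforce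
  \<comment> \<open>on the left and bottom edges the inside trace has the coefficient \<open>\<alpha> - u\<^sup>+\<close>; \<open>Ml\<close> and \<open>Mb\<close> bound it
    at both Gauss points at once\<close>
  define Ml where "Ml = max (\<alpha> - trace_plus Nx Ny u (Vert (i - 1) j) 1 $ 1) (\<alpha> - trace_plus Nx Ny u (Vert (i - 1) j) 2 $ 1)"
  define Mb where "Mb = max (\<alpha> - trace_plus Nx Ny u (Horz i (j - 1)) 1 $ 2) (\<alpha> - trace_plus Nx Ny u (Horz i (j - 1)) 2 $ 2)"
  have Ml: "S * Ml \<le> ?P (i - 1) l / 6" if "l \<in> {j - 1, j}" for l
  proof -
    have "S * (\<alpha> - trace_plus Nx Ny u (Vert (i - 1) j) \<beta> $ 1) \<le> ?P (i - 1) l / 6" if "\<beta> \<in> {1,2}" for \<beta>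
      by (rule cfl'[OF _ B1_lower])
        (use uV[of "i - 1" \<beta>] that \<open>l \<in> _\<close> ij in \<open>auto simp del: trace_plus.simps\<close>)
    then show ?thesis unfolding Ml_def max_def by fastforce
  qed
  have Mb: "S * Mb \<le> ?P k (j - 1) / 6" if "k \<in> {i - 1, i}" for k
  proof -
    have "S * (\<alpha> - trace_plus Nx Ny u (Horz i (j - 1)) \<beta> $ 2) \<le> ?P k (j - 1) / 6" if "\<beta> \<in> {1,2}" for \<beta>
      by (rule cfl'[OF _ B2_lower])
        (use uH[of "j - 1" \<beta>] that \<open>k \<in> _\<close> ij in \<open>auto simp del: trace_plus.simps\<close>)
    then show ?thesis unfolding Mb_def max_def by fastforce
  qed

  let ?F = "total_flux Nx Ny D \<alpha> \<alpha>t u v"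
  let ?v = "\<lambda>k l. v i j (node Nx k) (node Ny l)"
  note pen = pen1[unfolded sizes] pen2[unfolded sizes]
  have r1: "i - 1 \<in> {1..<Nx}" "i \<in> {1..<Nx}" "j - 1 \<in> {1..<Ny}" "j \<in> {1..<Ny}" "i - 1 + 1 = i" "j - 1 + 1 = j"
    using ij by auto
  note V = Vert_outflow_bound[where D = D and u = u, OF vW v_nonneg D_bounds(1,2) pen(1)]
  note H = Horz_outflow_bound[where D = D and u = u, OF vW v_nonneg D_bounds(3,4) pen(2)]
  have right: "edge_quad Nx Ny (Vert i j) ?F \<le> \<Delta>y / 2 * ((\<alpha> + (\<alpha>t + e1) / \<Delta>y) * (?v i (j - 1) + ?v i j)
      + d1 / (2 * \<Delta>x) * (?v (i - 1) (j - 1) + ?v (i - 1) j))"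
    unfolding sizes by (rule V(1)) (use r1 ij' positive uV in \<open>auto intro: less_imp_le simp del: trace_plus.simps\<close>)
  have left: "- edge_quad Nx Ny (Vert (i - 1) j) ?F
      \<le> \<Delta>y / 2 * ((Ml + (\<alpha>t + e1) / \<Delta>y) * (?v (i - 1) (j - 1) + ?v (i - 1) j)
      + d1 / (2 * \<Delta>x) * (?v i (j - 1) + ?v i j))"
    unfolding sizes by (rule V(2)[where k = "i - 1", unfolded r1])
      (use r1 ij' positive uV in \<open>auto intro: less_imp_le simp: Ml_def simp del: trace_plus.simps\<close>)
  have top: "edge_quad Nx Ny (Horz i j) ?F \<le> \<Delta>x / 2 * ((\<alpha> + (\<alpha>t + e2) / \<Delta>x) * (?v (i - 1) j + ?v i j)
      + d2 / (2 * \<Delta>y) * (?v (i - 1) (j - 1) + ?v i (j - 1)))"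
    unfolding sizes by (rule H(1)) (use r1 ij' positive uH in \<open>auto intro: less_imp_le simp del: trace_plus.simps\<close>)
  have bottom: "- edge_quad Nx Ny (Horz i (j - 1)) ?F
      \<le> \<Delta>x / 2 * ((Mb + (\<alpha>t + e2) / \<Delta>x) * (?v (i - 1) (j - 1) + ?v i (j - 1))
      + d2 / (2 * \<Delta>y) * (?v (i - 1) j + ?v i j))"
    unfolding sizes by (rule H(2)[where l = "j - 1", unfolded r1])
      (use r1 ij' positive uH in \<open>auto intro: less_imp_le simp: Mb_def simp del: trace_plus.simps\<close>)

  have vc: "?v (i - 1) (j - 1) \<ge> 0" "?v i (j - 1) \<ge> 0" "?v (i - 1) j \<ge> 0" "?v i j \<ge> 0"
    using corner(1)[OF ij'] by auto
  have mP: "Phi_min Nx Ny \<phi> \<le> ?P k l" if "k \<in> {i - 1, i}" "l \<in> {j - 1, j}" for k l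
    using that ij' by (intro Phi_min_le) auto
  let ?out = "\<Delta>y / 2 * ((Ml + (\<alpha>t + e1) / \<Delta>y) * (?v (i - 1) (j - 1) + ?v (i - 1) j) + d1 / (2 * \<Delta>x) * (?v i (j - 1) + ?v i j))
      + \<Delta>y / 2 * ((\<alpha> + (\<alpha>t + e1) / \<Delta>y) * (?v i (j - 1) + ?v i j) + d1 / (2 * \<Delta>x) * (?v (i - 1) (j - 1) + ?v (i - 1) j))
      + \<Delta>x / 2 * ((Mb + (\<alpha>t + e2) / \<Delta>x) * (?v (i - 1) (j - 1) + ?v i (j - 1)) + d2 / (2 * \<Delta>y) * (?v (i - 1) j + ?v i j))
      + \<Delta>x / 2 * ((\<alpha> + (\<alpha>t + e2) / \<Delta>x) * (?v (i - 1) j + ?v i j) + d2 / (2 * \<Delta>y) * (?v (i - 1) (j - 1) + ?v i (j - 1)))"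
  have "\<Delta>t / (\<Delta>x * \<Delta>y) * ?out
    \<le> (?P (i - 1) (j - 1) * ?v (i - 1) (j - 1) + ?P i (j - 1) * ?v i (j - 1)
        + ?P (i - 1) j * ?v (i - 1) j + ?P i j * ?v i j) / 8"
    by (rule cell_outflow_budget[OF h positive(5) vc, where m = "Phi_min Nx Ny \<phi>"])
      (use mP adv[unfolded S_def] Ml[unfolded S_def] Mb[unfolded S_def] diffusive in blast)+
  also have "\<dots> = cell_quad Nx Ny i j (w i j) / 2"
    using corner(2)[OF ij'] by (simp add: cell_quad_corners[OF wW ij'])
  \<comment> \<open>the outflow through the four edges consumes at most half of the cell average\<close>
  finally have flux: "- (\<Delta>t / (\<Delta>x * \<Delta>y) * net_inflow Nx Ny ?F i j) \<le> cell_quad Nx Ny i j (w i j) / 2"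
  proof (rule order_trans[rotated])
    have k: "\<Delta>t / (\<Delta>x * \<Delta>y) \<ge> 0" using h positive by simp
    show "- (\<Delta>t / (\<Delta>x * \<Delta>y) * net_inflow Nx Ny ?F i j) \<le> \<Delta>t / (\<Delta>x * \<Delta>y) * ?out"
      unfolding mult_minus_right[symmetric] net_inflow_def
      by (rule mult_left_mono[OF _ k]) (use right left top bottom in linarith)
  qed

  \<comment> \<open>compressibility and sinks each consume at most a sixth of \<open>w\<close>, pointwise at the Gauss points\<close>
  have source: "2 / 3 * w i j x y \<le> w i j x y + \<Delta>t * ((1 - ct x y) * q x y - z2 * w i j x y * pt i j x y)"
    if g: "x = gauss Nx i \<beta>" "y = gauss Ny j \<gamma>" "\<beta> \<in> {1,2}" "\<gamma> \<in> {1,2}" for x y \<beta> \<gamma>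
  proof -
    have int: "(x, y) \<in> interior (cell Nx Ny i j)" unfolding g using gauss_in_cell[OF mesh ij1] .
    then have xy: "(x, y) \<in> cell Nx Ny i j" using interior_subset by blast
    have w0: "w i j x y \<ge> 0" using w_nonneg[OF xy] .
    have v0: "v i j x y \<ge> 0" using v_nonneg[OF ij' xy] .
    have "\<Delta>t * (6 * z2 * p_max Nx Ny pt) \<le> 1"
      using ereal_le_inverse_imp[OF dt_z2] p_max_upper(2)[OF ij' g(3,4)] positive(2) by simp
    moreover have "\<Delta>t * (6 * z2 * pt i j x y) \<le> \<Delta>t * (6 * z2 * p_max Nx Ny pt)"
      using p_max_upper(1)[OF ij' g(3,4), of pt] positive(2,5) unfolding g by (intro mult_left_mono) auto
    ultimately have "\<Delta>t * (6 * z2 * pt i j x y) * w i j x y \<le> 1 * w i j x y"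
      using w0 by (intro mult_right_mono) auto
    then have p: "\<Delta>t * (z2 * w i j x y * pt i j x y) \<le> w i j x y / 6" by (simp add: algebra_simps)
    have ct: "0 \<le> 1 - ct x y" using ct_range cell_subset_square[OF mesh ij' xy] by fastforce
    have "- (\<Delta>t * ((1 - ct x y) * q x y)) \<le> w i j x y / 6"
    proof (cases "q x y < 0")
      case False
      then have "\<Delta>t * ((1 - ct x y) * q x y) \<ge> 0" using ct positive(5) by simp
      then show ?thesis using w0 by linarith
    next
      \<comment> \<open>at a sink the outgoing fluid has concentration \<open>v\<close>, and \<open>\<Delta>t (-q)\<close> is at most a sixth
        of the smallest corner porosity\<close>
      case True
      then have c: "1 - ct x y = v i j x y" using ct_sink ij' int unfolding v_def by fastforce
      have qn: "- q x y \<le> q_neg_max Nx Ny q i j" unfolding g using q_neg_max_upper[OF g(3,4)] .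
      have "ereal \<Delta>t \<le> ereal (Phi_cell_min Nx Ny \<phi> i j) / ereal (6 * q_neg_max Nx Ny q i j)"
        by (rule order_trans[OF dt_q], rule INF_lower2[OF ij'(1)], rule INF_lower2[OF ij'(2)]) simp
      then have "\<Delta>t * (6 * q_neg_max Nx Ny q i j) \<le> Phi_cell_min Nx Ny \<phi> i j"
        by (rule ereal_le_divide_imp) (use True qn in simp)
      moreover have "\<Delta>t * (6 * (- q x y)) \<le> \<Delta>t * (6 * q_neg_max Nx Ny q i j)"
        using qn positive(5) by (intro mult_left_mono) auto
      ultimately have "\<Delta>t * (6 * (- q x y)) * v i j x y \<le> Phi_cell_min Nx Ny \<phi> i j * v i j x y"
        using v0 by (intro mult_right_mono) auto
      also have "\<dots> \<le> w i j x y" using w_ge[OF xy] .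
      finally show ?thesis unfolding c by (simp add: algebra_simps)
    qed
    then show ?thesis using p unfolding right_diff_distrib[of \<Delta>t] by linarith
  qed
  have "2 / 3 * cell_quad Nx Ny i j (w i j) \<le> cell_quad Nx Ny i j
      (\<lambda>x y. w i j x y + \<Delta>t * ((1 - ct x y) * q x y - z2 * w i j x y * pt i j x y))"
    unfolding cell_quad_def times_divide_eq_right sum_distrib_left
    by (intro divide_right_mono sum_mono source[OF refl refl]) auto
  moreover have "0 \<le> cell_quad Nx Ny i j (w i j)"
    unfolding cell_quad_def using gauss_in_cell[OF mesh ij1] interior_subset
    by (intro divide_nonneg_nonneg sum_nonneg w_nonneg) auto
  ultimately show "cell_avg Nx Ny r' i j \<le> cell_avg Nx Ny (Phi Nx Ny \<phi>) i j"
    using complement_balance[OF mesh positive(5) scheme ij] flux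
    unfolding v_def w_def sizes by argo
qed

end
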